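(* Let $d\ge1$, $1\le p<\infty$, $s\in\mathbb{R}$, let $U$ be distributed according to the $B^s_{pp}$ prior on $\mathbb{T}^d$, and let $t<s-\frac dp$. Put $Y:=B^t_{pp}(\mathbb{T}^d)$ and let $T_n:Y\to Y$ be the linear operators $$T_n\Big(\sum_{\ell=1}^\infty c_\ell\psi_\ell\Big)=\sum_{\ell=1}^nc_\ell\psi_\ell .$$ Then $\lim_{n\to\infty}T_ny=y$ for all $y\in Y$, and $U_n=T_nU$, $n=1,2,\dots$, are proper linear discretizations of $U$ in $Y$.
   Context: Besov spaces. $\mathbb{T}^d$ is the $d$-dimensional torus. $(\psi_\ell)_{\ell\ge1}$ is a fixed orthonormal basis of $L^2(\mathbb{T}^d)$ consisting of periodized, compactly supported tensor-product wavelets of regularity large enough for all smoothness indices used; $\psi_1$ is the scaling function and the wavelets are numbered scale by scale, scale $j\ge0$ corresponding to $2^{jd}+1\le\ell\le2^{(j+1)d}$ (with $\ell=2,\dots,2^d$ for $j=0$). For $\sigma\in\mathbb{R}$ and $1\le p<\infty$ the Besov norm is by definition $$\Big\|\sum_{\ell=1}^\infty c_\ell\psi_\ell\Big\|_{B^\sigma_{pp}(\mathbb{T}^d)}=\Big(\sum_{\ell=1}^\infty\ell^{\,p\sigma/d+p/2-1}|c_\ell|^p\Big)^{1/p}.$$ Prior. "$U$ is distributed according to the $B^s_{pp}$ prior" means $U=\sum_{\ell\ge1}\ell^{-(s/d+1/2-1/p)}X_\ell\psi_\ell$ with $X_\ell$ i.i.d. real random variables with density $c_p\exp(-|x|^p)$,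 $c_p=(\int_{\mathbb{R}}e^{-|x|^p}dx)^{-1}$. Proper linear discretizations. Let $Y$ be a separable Banach space, $Y_n\subset Y$ finite-dimensional subspaces, and $U_n$ be $Y_n$-valued random variables, $n\ge1$. The $U_n$ are called proper linear discretizations of a $Y$-valued random variable $U$ in $Y$ if (1) $U_n\to U$ weakly in distribution, i.e. for every $y'\in Y'$ the scalar random variables $\langle U_n,y'\rangle$ converge to $\langle U,y'\rangle$ in distribution as $n\to\infty$; and (2) there are bounded linear operators $T_n$ on $Y$ such that $U_n=T_nU$. *)

theory Defs
  imports "HOL-Probability.Probability" "HOL-Library.Function_Algebras"
begin

text \<open>Pointwise real vector space structure on functions, so that \<open>subspace\<close> and \<open>span\<close> are available
  for spaces of functions and of functionals.\<close>

instantiation "fun" :: (type, real_vector) real_vector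
begin

definition scaleR_fun :: "real \<Rightarrow> ('a \<Rightarrow> 'b) \<Rightarrow> 'a \<Rightarrow> 'b" where
  "scaleR_fun a f = (\<lambda>x. a *\<^sub>R f x)"

instance
  by standard (simp_all add: scaleR_fun_def fun_eq_iff scaleR_add_right scaleR_add_left)

end

lemma scaleR_fun_apply [simp]: "(a *\<^sub>R f) x = a *\<^sub>R f x"
  by (simp add: scaleR_fun_def)


section \<open>Normed spaces given by a carrier and a norm\<close>

definition normed_space_on :: "'y::real_vector set \<Rightarrow> ('y \<Rightarrow> real) \<Rightarrow> bool" where
  "normed_space_on Y N \<longleftrightarrow> subspace Y \<and>
     (\<forall>x\<in>Y. 0 \<le> N x \<and> (N x = 0 \<longleftrightarrow> x = 0)) \<and>
     (\<forall>a. \<forall>x\<in>Y. N (a *\<^sub>R x) = \<bar>a\<bar> * N x) \<and>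
     (\<forall>x\<in>Y. \<forall>y\<in>Y. N (x + y) \<le> N x + N y)"

definition norm_topology :: "'y::real_vector set \<Rightarrow> ('y \<Rightarrow> real) \<Rightarrow> 'y topology" where
  "norm_topology Y N = Metric_space.mtopology Y (\<lambda>x y. N (x - y))"

definition separable_banach_on :: "'y::real_vector set \<Rightarrow> ('y \<Rightarrow> real) \<Rightarrow> bool" where
  "separable_banach_on Y N \<longleftrightarrow> normed_space_on Y N \<and>
     Metric_space.mcomplete Y (\<lambda>x y. N (x - y)) \<and> separable_space (norm_topology Y N)"

definition borel_on :: "'y::real_vector set \<Rightarrow> ('y \<Rightarrow> real) \<Rightarrow> 'y measure" where
  "borel_on Y N = sigma Y {G. openin (norm_topology Y N) G}"

text \<open>Here \<open>K\<close> is the norm of the codomain.\<close>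

definition bounded_linear_on ::
  "'y::real_vector set \<Rightarrow> ('y \<Rightarrow> real) \<Rightarrow> ('z::real_vector \<Rightarrow> real) \<Rightarrow> ('y \<Rightarrow> 'z) \<Rightarrow> bool" where
  "bounded_linear_on Y N K T \<longleftrightarrow>
     (\<forall>x\<in>Y. \<forall>y\<in>Y. T (x + y) = T x + T y) \<and>
     (\<forall>a. \<forall>x\<in>Y. T (a *\<^sub>R x) = a *\<^sub>R T x) \<and>
     (\<exists>C. \<forall>x\<in>Y. K (T x) \<le> C * N x)"

definition bounded_operator_on ::
  "'y::real_vector set \<Rightarrow> ('y \<Rightarrow> real) \<Rightarrow> ('y \<Rightarrow> 'y) \<Rightarrow> bool" where
  "bounded_operator_on Y N T \<longleftrightarrow> T ` Y \<subseteq> Y \<and> bounded_linear_on Y N N T"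

definition dual_on :: "'y::real_vector set \<Rightarrow> ('y \<Rightarrow> real) \<Rightarrow> ('y \<Rightarrow> real) set" where
  "dual_on Y N = {y'. bounded_linear_on Y N abs y'}"

definition finite_dim_subspace :: "'y::real_vector set \<Rightarrow> bool" where
  "finite_dim_subspace V \<longleftrightarrow> (\<exists>B. finite B \<and> V = span B)"

definition proper_linear_discretizations ::
  "'w measure \<Rightarrow> 'y::real_vector set \<Rightarrow> ('y \<Rightarrow> real) \<Rightarrow> ('w \<Rightarrow> 'y) \<Rightarrow> (nat \<Rightarrow> 'w \<Rightarrow> 'y) \<Rightarrow> bool"
where
  "proper_linear_discretizations M Y N U Us \<longleftrightarrow>
     separable_banach_on Y N \<and>
     U \<in> M \<rightarrow>\<^sub>M borel_on Y N \<and>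
     (\<forall>n\<ge>1. \<exists>Yn. finite_dim_subspace Yn \<and> Yn \<subseteq> Y \<and> Us n \<in> M \<rightarrow>\<^sub>M borel_on Yn N) \<and>
     (\<forall>y'\<in>dual_on Y N.
        weak_conv_m (\<lambda>n. distr M borel (\<lambda>\<omega>. y' (Us n \<omega>))) (distr M borel (\<lambda>\<omega>. y' (U \<omega>)))) \<and>
     (\<exists>T. \<forall>n\<ge>1. bounded_operator_on Y N (T n) \<and> (\<forall>\<omega>\<in>space M. Us n \<omega> = T n (U \<omega>)))"

text \<open>A random element is determined only almost surely; \<open>V\<close> is a representative of \<open>U\<close> with all its
  values in \<open>Y\<close>.\<close>

definition valued_version ::
  "'w measure \<Rightarrow> 'y::real_vector set \<Rightarrow> ('y \<Rightarrow> real) \<Rightarrow> ('w \<Rightarrow> 'y) \<Rightarrow> ('w \<Rightarrow> 'y) \<Rightarrow> bool" where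
  "valued_version M Y N U V \<longleftrightarrow> V \<in> M \<rightarrow>\<^sub>M borel_on Y N \<and> (AE \<omega> in M. V \<omega> = U \<omega>)"


section \<open>Wavelet bases of the torus\<close>

text \<open>Functions on the torus are 1-periodic functions on Euclidean space, integrated over the unit
  cube.\<close>

definition torus :: "(real^'d) measure" where
  "torus = restrict_space lborel {x. \<forall>i. 0 \<le> x $ i \<and> x $ i < 1}"

definition torus_L2 :: "(real^'d \<Rightarrow> real) set" where
  "torus_L2 = {f \<in> borel_measurable torus. integrable torus (\<lambda>x. (f x)\<^sup>2)}"

definition torus_inner :: "(real^'d \<Rightarrow> real) \<Rightarrow> (real^'d \<Rightarrow> real) \<Rightarrow> real" where
  "torus_inner f g = (LINT x|torus. f x * g x)"

definition torus_orthonormal :: "(nat \<Rightarrow> real^'d \<Rightarrow> real) \<Rightarrow> bool" where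
  "torus_orthonormal \<psi> \<longleftrightarrow> (\<forall>k\<ge>1. \<psi> k \<in> torus_L2) \<and>
     (\<forall>k\<ge>1. \<forall>l\<ge>1. torus_inner (\<psi> k) (\<psi> l) = (if k = l then 1 else 0))"

definition torus_orthonormal_basis :: "(nat \<Rightarrow> real^'d \<Rightarrow> real) \<Rightarrow> bool" where
  "torus_orthonormal_basis \<psi> \<longleftrightarrow> torus_orthonormal \<psi> \<and>
     (\<forall>f\<in>torus_L2.
        (\<lambda>n. LINT x|torus. (f x - (\<Sum>l=1..n. torus_inner f (\<psi> l) * \<psi> l x))\<^sup>2) \<longlonglongrightarrow> 0)"

definition C_k :: "nat \<Rightarrow> (real \<Rightarrow> real) \<Rightarrow> bool" where
  "C_k r f \<longleftrightarrow>
     (\<forall>i<r. \<forall>x. ((deriv ^^ i) f has_real_derivative (deriv ^^ Suc i) f x) (at x)) \<and>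
     continuous_on UNIV ((deriv ^^ r) f)"

text \<open>A compactly supported orthonormal scaling function \<open>\<phi>\<close> of class \<open>C\<close>-\<open>r\<close> with associated
  wavelet \<open>\<mu>\<close>. Orthogonality between different scales follows from the two-scale relations.\<close>

definition wavelet_pair :: "nat \<Rightarrow> (real \<Rightarrow> real) \<Rightarrow> (real \<Rightarrow> real) \<Rightarrow> bool" where
  "wavelet_pair r \<phi> \<mu> \<longleftrightarrow>
     C_k r \<phi> \<and> C_k r \<mu> \<and>
     (\<exists>R. \<forall>x. R < \<bar>x\<bar> \<longrightarrow> \<phi> x = 0 \<and> \<mu> x = 0) \<and>
     (\<exists>K :: int set. \<exists>a b. finite K \<and>
        (\<forall>x. \<phi> x = (\<Sum>k\<in>K. a k * \<phi> (2 * x - of_int k))) \<and>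
        (\<forall>x. \<mu> x = (\<Sum>k\<in>K. b k * \<phi> (2 * x - of_int k)))) \<and>
     (\<forall>k l :: int.
        (LINT x|lborel. \<phi> (x - of_int k) * \<phi> (x - of_int l)) = (if k = l then 1 else 0) \<and>
        (LINT x|lborel. \<mu> (x - of_int k) * \<mu> (x - of_int l)) = (if k = l then 1 else 0) \<and>
        (LINT x|lborel. \<phi> (x - of_int k) * \<mu> (x - of_int l)) = 0)"

definition tensor_wavelet ::
  "(real \<Rightarrow> real) \<Rightarrow> (real \<Rightarrow> real) \<Rightarrow> 'd::finite set \<Rightarrow> real^'d \<Rightarrow> real" where
  "tensor_wavelet \<phi> \<mu> E x = (\<Prod>i\<in>UNIV. (if i \<in> E then \<mu> else \<phi>) (x $ i))"

definition dilate :: "nat \<Rightarrow> nat^'d \<Rightarrow> (real^'d \<Rightarrow> real) \<Rightarrow> real^'d \<Rightarrow> real" where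
  "dilate j k F x =
     2 powr (real j * real CARD('d) / 2) * F (\<chi> i. 2 ^ j * x $ i - real (k $ i))"

definition periodize :: "(real^'d \<Rightarrow> real) \<Rightarrow> real^'d \<Rightarrow> real" where
  "periodize F x = (\<Sum>\<^sub>\<infinity>m\<in>(UNIV :: (int^'d) set). F (x + (\<chi> i. of_int (m $ i))))"

text \<open>The wavelets of scale \<open>j\<close> are indexed by a nonempty set \<open>E\<close> of coordinates carrying \<open>\<mu>\<close> and a
  translation \<open>k\<close>; their order within a scale is arbitrary.\<close>

definition torus_wavelet_basis :: "nat \<Rightarrow> (nat \<Rightarrow> real^'d \<Rightarrow> real) \<Rightarrow> bool" where
  "torus_wavelet_basis r \<psi> \<longleftrightarrow>
     torus_orthonormal_basis \<psi> \<and>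
     (\<exists>\<phi> \<mu>. wavelet_pair r \<phi> \<mu> \<and>
        \<psi> 1 = periodize (tensor_wavelet \<phi> \<mu> {}) \<and>
        (\<forall>j. \<exists>\<nu>. bij_betw \<nu> {2 ^ (j * CARD('d)) + 1..2 ^ ((j + 1) * CARD('d))}
                    ({E :: 'd set. E \<noteq> {}} \<times> {k :: nat^'d. \<forall>i. k $ i < 2 ^ j}) \<and>
             (\<forall>l\<in>{2 ^ (j * CARD('d)) + 1..2 ^ ((j + 1) * CARD('d))}.
                \<psi> l = periodize (dilate j (snd (\<nu> l)) (tensor_wavelet \<phi> \<mu> (fst (\<nu> l)))))))"


section \<open>Wavelet series and Besov spaces\<close>

text \<open>The series \<open>\<Sum> c\<^sub>l \<psi>\<^sub>l\<close> is a generalized function, represented by its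
  \<open>L\<^sup>2\<close>-pairing with finite linear combinations of the \<open>\<psi>\<^sub>l\<close>, where only finitely many terms are
  nonzero. The functional determines the coefficients, for negative smoothness too; the value at
  all other arguments is fixed to be 0. Coefficient sequences are indexed from 1.\<close>

type_synonym 'd genfun = "(real^'d \<Rightarrow> real) \<Rightarrow> real"

definition wavelet_series :: "(nat \<Rightarrow> real^'d \<Rightarrow> real) \<Rightarrow> (nat \<Rightarrow> real) \<Rightarrow> 'd genfun" where
  "wavelet_series \<psi> c = (\<lambda>f. if f \<in> span (\<psi> ` {1..})
      then (\<Sum>\<^sub>\<infinity>l\<in>{1..}. c l * torus_inner (\<psi> l) f) else 0)"

definition wavelet_coeff :: "(nat \<Rightarrow> real^'d \<Rightarrow> real) \<Rightarrow> 'd genfun \<Rightarrow> nat \<Rightarrow> real" where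
  "wavelet_coeff \<psi> u l = u (\<psi> l)"

definition besov_term :: "nat \<Rightarrow> real \<Rightarrow> real \<Rightarrow> (nat \<Rightarrow> real) \<Rightarrow> nat \<Rightarrow> real" where
  "besov_term d p \<sigma> c l = real l powr (p * \<sigma> / real d + p / 2 - 1) * \<bar>c l\<bar> powr p"

definition besov_norm :: "(nat \<Rightarrow> real^'d \<Rightarrow> real) \<Rightarrow> real \<Rightarrow> real \<Rightarrow> 'd genfun \<Rightarrow> real" where
  "besov_norm \<psi> p \<sigma> u =
     (\<Sum>\<^sub>\<infinity>l\<in>{1..}. besov_term CARD('d) p \<sigma> (wavelet_coeff \<psi> u) l) powr (1 / p)"

definition besov_space :: "(nat \<Rightarrow> real^'d \<Rightarrow> real) \<Rightarrow> real \<Rightarrow> real \<Rightarrow> 'd genfun set" where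
  "besov_space \<psi> p \<sigma> =
     {wavelet_series \<psi> c | c. besov_term CARD('d) p \<sigma> c summable_on {1..}}"

definition wavelet_truncation ::
  "(nat \<Rightarrow> real^'d \<Rightarrow> real) \<Rightarrow> nat \<Rightarrow> 'd genfun \<Rightarrow> 'd genfun" where
  "wavelet_truncation \<psi> n u =
     wavelet_series \<psi> (\<lambda>l. if l \<le> n then wavelet_coeff \<psi> u l else 0)"

lemma wavelet_coeff_series:
  assumes "torus_orthonormal \<psi>" "l \<ge> 1"
  shows "wavelet_coeff \<psi> (wavelet_series \<psi> c) l = c l"
proof -
  have "\<psi> l \<in> span (\<psi> ` {1..})"
    using assms(2) by (intro span_base) auto
  moreover have "(\<Sum>\<^sub>\<infinity>k\<in>{1..}. c k * torus_inner (\<psi> k) (\<psi> l)) = (\<Sum>\<^sub>\<infinity>k\<in>{l}. c k)"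
    using assms by (intro infsum_cong_neutral) (auto simp: torus_orthonormal_def)
  ultimately show ?thesis
    by (simp add: wavelet_coeff_def wavelet_series_def)
qed

lemma besov_norm_series:
  fixes \<psi> :: "nat \<Rightarrow> real^'d \<Rightarrow> real"
  assumes "torus_orthonormal \<psi>"
  shows "besov_norm \<psi> p \<sigma> (wavelet_series \<psi> c) =
     (\<Sum>\<^sub>\<infinity>l\<in>{1..}. real l powr (p * \<sigma> / real CARD('d) + p / 2 - 1) * \<bar>c l\<bar> powr p) powr (1 / p)"
  unfolding besov_norm_def besov_term_def
  by (intro arg_cong[where f = "\<lambda>x. x powr (1 / p)"] infsum_cong)
    (simp add: wavelet_coeff_series[OF assms])

lemma wavelet_truncation_series:
  fixes \<psi> :: "nat \<Rightarrow> real^'d \<Rightarrow> real"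
  assumes "torus_orthonormal \<psi>"
  shows "wavelet_truncation \<psi> n (wavelet_series \<psi> c) =
    wavelet_series \<psi> (\<lambda>l. if l \<le> n then c l else 0)"
proof -
  have "(\<Sum>\<^sub>\<infinity>l\<in>{1..}. (if l \<le> n then wavelet_coeff \<psi> (wavelet_series \<psi> c) l else 0) * torus_inner (\<psi> l) f)
      = (\<Sum>\<^sub>\<infinity>l\<in>{1..}. (if l \<le> n then c l else 0) * torus_inner (\<psi> l) f)" for f
    by (intro infsum_cong) (simp add: wavelet_coeff_series[OF assms])
  then show ?thesis
    unfolding wavelet_truncation_def wavelet_series_def[of \<psi> "\<lambda>l. if l \<le> n then _ l else 0"]
    by (simp add: fun_eq_iff)
qed


section \<open>The Besov prior\<close>

definition besov_prior ::
  "'w measure \<Rightarrow> (nat \<Rightarrow> real^'d \<Rightarrow> real) \<Rightarrow> real \<Rightarrow> real \<Rightarrow> ('w \<Rightarrow> 'd genfun) \<Rightarrow> bool" where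
  "besov_prior M \<psi> p s U \<longleftrightarrow>
     (\<exists>X :: nat \<Rightarrow> 'w \<Rightarrow> real.
        prob_space.indep_vars M (\<lambda>_. borel) X {1..} \<and>
        (\<forall>l\<ge>1. distributed M lborel (X l)
           (\<lambda>x. ennreal (exp (- (\<bar>x\<bar> powr p)) / (LINT z|lborel. exp (- (\<bar>z\<bar> powr p)))))) \<and>
        (AE \<omega> in M. U \<omega> = wavelet_series \<psi>
           (\<lambda>l. real l powr (- (s / real CARD('d) + 1 / 2 - 1 / p)) * X l \<omega>)))"

end

theory Submission
  imports Defs
begin

text \<open>In coefficients, the Besov space is a weighted \<open>l\<^sup>p\<close> space with the sequences starting at index 1.
  There truncations are contractions that converge strongly to the identity, because the tails of a
  convergent series vanish. The prior lies in the space almost surely since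
  \<open>\<Sum> l powr (p * (t - s) / d) * |X\<^sub>l| powr p\<close> has finite expectation for \<open>p * (t - s) / d < -1\<close>.
  As \<open>T\<^sub>n V \<rightarrow> V\<close> pointwise in norm, every bounded functional converges
  pointwise, hence in distribution. By separability the Borel sets are generated by balls, which
  reduces the measurability of random elements to that of their distances to fixed points.\<close>

section \<open>Weighted sequence spaces\<close>

text \<open>The series of the prior is a generalized function at every outcome, because a test
  function in the span of the wavelets pairs nontrivially with only finitely many of them. Chance
  decides only whether the coefficients meet the Besov condition. The threshold for t comes from
  cancellation: the weight exponent \<open>p * t / d + p / 2 - 1\<close> minus p times the prior
  decay \<open>s / d + 1 / 2 - 1 / p\<close> leaves \<open>p * (t - s) / d\<close>, which is below
  \<open>-1\<close> exactly when \<open>t < s - d / p\<close>. Measurability into the norm Borel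
  sets asks for values in the space at every outcome, whereas the prior provides this only almost
  surely; so U is modified on a null set, and the discretization property is proved for an arbitrary
  measurable V.\<close>

lemma powr_convex_nonneg:
  fixes x y :: real
  assumes "p \<ge> 1" "a \<ge> 0" "b \<ge> 0" "a + b = 1" "x \<ge> 0" "y \<ge> 0"
  shows "(a * x + b * y) powr p \<le> a * x powr p + b * y powr p"
proof -
  \<comment> \<open>Serves the boundary cases \<open>x = 0\<close> and \<open>y = 0\<close>, where
    convexity reduces to \<open>c powr p \<le> c\<close> for c between 0 and 1.\<close>
  have scale: "(c * z) powr p \<le> c * z powr p" if "0 \<le> c" "c \<le> 1" "z \<ge> 0" for c z :: real
  proof (cases "c = 0")
    case False
    with that assms have "c powr p \<le> c powr 1"
      by (intro powr_mono') auto
    with that False show ?thesis by (simp add: powr_mult mult_right_mono)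
  qed simp
  consider "x = 0" | "y = 0" | "x > 0" "y > 0"
    using assms by force
  then show ?thesis
  proof cases
    case 3
    then show ?thesis
      using powr_convex[OF assms(1)] assms unfolding convex_on_def by auto
  qed (use scale[of a x] scale[of b y] assms in \<open>auto simp: \<open>p \<ge> 1\<close>\<close>)
qed

text \<open>The segments \<open>{1..n}\<close> eventually contain every finite subset of
  \<open>{1..}\<close>. This turns unordered sums into sequential limits, as the tail estimate and
  measurability require.\<close>

lemma sum_tendsto_infsum:
  fixes f :: "nat \<Rightarrow> real"
  assumes "f summable_on {1..}"
  shows "(\<lambda>n. sum f {1..n}) \<longlonglongrightarrow> infsum f {1..}"
proof -
  have "filterlim (\<lambda>n. {1..n}) (finite_subsets_at_top {1::nat..}) sequentially"
    unfolding filterlim_finite_subsets_at_top eventually_sequentially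
  proof safe
    fix X :: "nat set" assume X: "finite X" "X \<subseteq> {1..}"
    then show "\<exists>N. \<forall>n\<ge>N. finite {1..n} \<and> X \<subseteq> {1..n} \<and> {1..n} \<subseteq> {1..}"
      by (intro exI[of _ "Max X"]) (use X in \<open>auto intro: order_trans[OF Max_ge]\<close>)
  qed
  from filterlim_compose[OF infsum_tendsto[OF assms] this] show ?thesis .
qed

text \<open>Positivity is asked from index 1 on because the Besov weight vanishes at 0, where
  \<open>0 powr x = 0\<close>.\<close>

locale weighted_lp =
  fixes w :: "nat \<Rightarrow> real" and p :: real
  assumes p: "1 \<le> p" and w: "l \<ge> 1 \<Longrightarrow> w l > 0"
begin

definition lp :: "(nat \<Rightarrow> real) \<Rightarrow> bool" where
  "lp c \<longleftrightarrow> (\<lambda>l. w l * \<bar>c l\<bar> powr p) summable_on {1..}"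

definition lp_norm :: "(nat \<Rightarrow> real) \<Rightarrow> real" where
  "lp_norm c = (\<Sum>\<^sub>\<infinity>l\<in>{1..}. w l * \<bar>c l\<bar> powr p) powr (1 / p)"

lemma term_nonneg: "l \<in> {1..} \<Longrightarrow> 0 \<le> w l * \<bar>c l\<bar> powr p"
  using w[of l] by simp

lemma lp_norm_nonneg [simp]: "0 \<le> lp_norm c"
  by (simp add: lp_norm_def)

lemma lp_norm_powr: "lp_norm c powr p = (\<Sum>\<^sub>\<infinity>l\<in>{1..}. w l * \<bar>c l\<bar> powr p)"
proof -
  have "0 \<le> (\<Sum>\<^sub>\<infinity>l\<in>{1..}. w l * \<bar>c l\<bar> powr p)"
    by (intro infsum_nonneg term_nonneg)
  then show ?thesis using p by (simp add: lp_norm_def powr_powr)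
qed

lemma powr_le_imp_le:
  fixes A B :: real
  assumes "A powr p \<le> B powr p" "B \<ge> 0"
  shows "A \<le> B"
  using assms p powr_less_mono2[of p B A] by (cases "A \<le> B") auto

lemma lp_finite_sum_le:
  assumes "lp c" "finite F" "F \<subseteq> {1..}"
  shows "(\<Sum>l\<in>F. w l * \<bar>c l\<bar> powr p) \<le> lp_norm c powr p"
  unfolding lp_norm_powr using assms term_nonneg[of _ c]
  by (intro finite_sum_le_infsum) (auto simp: lp_def)

text \<open>Nonnegative terms are summable once their finite sums are bounded, so one estimate over
  finite sets yields membership and the norm bound together. Minkowski, completeness and density all
  go through it.\<close>

lemma lpI:
  assumes le: "\<And>F. finite F \<Longrightarrow> F \<subseteq> {1..} \<Longrightarrow> (\<Sum>l\<in>F. w l * \<bar>c l\<bar> powr p) \<le> B powr p"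
    and B: "B \<ge> 0"
  shows "lp c" "lp_norm c \<le> B"
proof -
  show *: "lp c" unfolding lp_def
    by (intro nonneg_bdd_above_summable_on term_nonneg bdd_aboveI[of _ "B powr p"])
      (auto intro!: le)
  have "lp_norm c powr p \<le> B powr p"
    unfolding lp_norm_powr
    by (intro infsum_le_finite_sums le) (use * in \<open>auto simp: lp_def\<close>)
  then show "lp_norm c \<le> B" using B by (rule powr_le_imp_le)
qed

text \<open>A single term is at most the whole sum. Definiteness of the norm and the coordinatewise
  limits of Cauchy sequences rest on this continuity of the coordinates.\<close>

lemma lp_coord_le:
  assumes "lp c" "l \<ge> 1"
  shows "\<bar>c l\<bar> \<le> lp_norm c / w l powr (1 / p)"
proof -
  have "w l * \<bar>c l\<bar> powr p \<le> lp_norm c powr p"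
    using lp_finite_sum_le[OF assms(1), of "{l}"] assms(2) by simp
  moreover have "(w l powr (1 / p) * \<bar>c l\<bar>) powr p = w l * \<bar>c l\<bar> powr p"
    using w[OF assms(2)] p by (simp add: powr_mult powr_powr)
  ultimately have "w l powr (1 / p) * \<bar>c l\<bar> \<le> lp_norm c"
    using powr_le_imp_le[OF _ lp_norm_nonneg] by metis
  then show ?thesis using w[OF assms(2)] by (simp add: field_simps)
qed

lemma lp_norm_eq_0D: "lp c \<Longrightarrow> lp_norm c = 0 \<Longrightarrow> l \<ge> 1 \<Longrightarrow> c l = 0"
  using lp_coord_le[of c l] by simp

lemma lp_zero: "lp (\<lambda>_. 0)" "lp_norm (\<lambda>_. 0) = 0"
  by (auto simp: lp_def lp_norm_def)

lemma lp_scale: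
  assumes "lp c"
  shows "lp (\<lambda>l. a * c l)" "lp_norm (\<lambda>l. a * c l) = \<bar>a\<bar> * lp_norm c"
proof -
  have eq: "(\<lambda>l. w l * \<bar>a * c l\<bar> powr p) = (\<lambda>l. \<bar>a\<bar> powr p * (w l * \<bar>c l\<bar> powr p))"
    by (simp add: abs_mult powr_mult fun_eq_iff)
  show "lp (\<lambda>l. a * c l)"
    using assms unfolding lp_def eq by (intro summable_on_cmult_right)
  have "lp_norm (\<lambda>l. a * c l) = (\<bar>a\<bar> powr p * lp_norm c powr p) powr (1 / p)"
    unfolding lp_norm_powr by (subst lp_norm_def) (simp add: eq infsum_cmult_right')
  then show "lp_norm (\<lambda>l. a * c l) = \<bar>a\<bar> * lp_norm c"
    using p by (simp add: powr_mult powr_powr)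
qed

lemma lp_bounded_by:
  assumes "lp c" "\<And>l. \<bar>c' l\<bar> \<le> \<bar>c l\<bar>"
  shows "lp c'" "lp_norm c' \<le> lp_norm c"
proof -
  have "(\<Sum>l\<in>F. w l * \<bar>c' l\<bar> powr p) \<le> lp_norm c powr p" if "finite F" "F \<subseteq> {1..}" for F
  proof -
    have "(\<Sum>l\<in>F. w l * \<bar>c' l\<bar> powr p) \<le> (\<Sum>l\<in>F. w l * \<bar>c l\<bar> powr p)"
      using that assms(2) w p
      by (intro sum_mono mult_left_mono powr_mono2) (auto intro: less_imp_le)
    also have "\<dots> \<le> lp_norm c powr p" using lp_finite_sum_le assms that by blast
    finally show ?thesis .
  qed
  from lpI[OF this] show "lp c'" "lp_norm c' \<le> lp_norm c" by auto
qed

text \<open>Minkowski's inequality is convexity of the \<open>p\<close>-th power at the point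
  \<open>(c + c') / (A + B) = a (c / A) + b (c' / B)\<close> with \<open>a = A / (A + B)\<close>, \<open>b = B / (A + B)\<close>, where
  \<open>A\<close> and \<open>B\<close> exceed the two norms (strictly, so that they may be divided by).\<close>

lemma lp_add_aux:
  assumes "lp c" "lp c'" "lp_norm c < A" "lp_norm c' < B"
  shows "lp (\<lambda>l. c l + c' l)" "lp_norm (\<lambda>l. c l + c' l) \<le> A + B"
proof -
  have AB: "A > 0" "B > 0" using assms(3,4) lp_norm_nonneg[of c] lp_norm_nonneg[of c'] by linarith+
  define a b where "a = A / (A + B)" and "b = B / (A + B)"
  have ab: "a \<ge> 0" "b \<ge> 0" "a + b = 1"
    using AB by (auto simp: a_def b_def simp flip: add_divide_distrib)
  have "(\<Sum>l\<in>F. w l * \<bar>c l + c' l\<bar> powr p) \<le> (A + B) powr p" if F: "finite F" "F \<subseteq> {1..}" for F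
  proof -
    have le: "\<bar>c l + c' l\<bar> powr p \<le>
        (A + B) powr p * (a * (\<bar>c l\<bar> powr p / A powr p) + b * (\<bar>c' l\<bar> powr p / B powr p))" for l
    proof -
      have "\<bar>c l + c' l\<bar> \<le> (A + B) * (a * (\<bar>c l\<bar> / A) + b * (\<bar>c' l\<bar> / B))"
        using AB by (simp add: a_def b_def distrib_left)
      then have "\<bar>c l + c' l\<bar> powr p \<le> ((A + B) * (a * (\<bar>c l\<bar> / A) + b * (\<bar>c' l\<bar> / B))) powr p"
        using p by (intro powr_mono2) auto
      also have "\<dots> = (A + B) powr p * (a * (\<bar>c l\<bar> / A) + b * (\<bar>c' l\<bar> / B)) powr p"
        using AB ab by (intro powr_mult)
      also have "\<dots> \<le> (A + B) powr p * (a * (\<bar>c l\<bar> / A) powr p + b * (\<bar>c' l\<bar> / B) powr p)"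
        using AB ab p by (intro mult_left_mono powr_convex_nonneg) auto
      finally show ?thesis using AB by (simp add: powr_divide)
    qed
    have "(\<Sum>l\<in>F. w l * \<bar>c l + c' l\<bar> powr p) \<le>
        (\<Sum>l\<in>F. w l * ((A + B) powr p * (a * (\<bar>c l\<bar> powr p / A powr p) + b * (\<bar>c' l\<bar> powr p / B powr p))))"
      using F w by (intro sum_mono mult_left_mono le) (auto intro: less_imp_le)
    also have "\<dots> = (A + B) powr p * (a * ((\<Sum>l\<in>F. w l * \<bar>c l\<bar> powr p) / A powr p) +
        b * ((\<Sum>l\<in>F. w l * \<bar>c' l\<bar> powr p) / B powr p))"
      by (simp add: sum_distrib_left sum_divide_distrib sum.distrib algebra_simps)
    also have "\<dots> \<le> (A + B) powr p * (a * 1 + b * 1)"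
    proof (intro mult_left_mono add_mono)
      have "(\<Sum>l\<in>F. w l * \<bar>c l\<bar> powr p) \<le> A powr p"
        by (rule order_trans[OF lp_finite_sum_le[OF assms(1) F]])
          (use assms(3) p in \<open>auto intro!: powr_mono2\<close>)
      then show "(\<Sum>l\<in>F. w l * \<bar>c l\<bar> powr p) / A powr p \<le> 1" using AB by simp
      have "(\<Sum>l\<in>F. w l * \<bar>c' l\<bar> powr p) \<le> B powr p"
        by (rule order_trans[OF lp_finite_sum_le[OF assms(2) F]])
          (use assms(4) p in \<open>auto intro!: powr_mono2\<close>)
      then show "(\<Sum>l\<in>F. w l * \<bar>c' l\<bar> powr p) / B powr p \<le> 1" using AB by simp
    qed (use ab in auto)
    finally show ?thesis using ab by simp
  qed
  from lpI[OF this] AB show "lp (\<lambda>l. c l + c' l)" "lp_norm (\<lambda>l. c l + c' l) \<le> A + B" by auto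
qed

lemma lp_add:
  assumes "lp c" "lp c'"
  shows "lp (\<lambda>l. c l + c' l)" "lp_norm (\<lambda>l. c l + c' l) \<le> lp_norm c + lp_norm c'"
proof -
  show "lp (\<lambda>l. c l + c' l)"
    using lp_add_aux(1)[OF assms, of "lp_norm c + 1" "lp_norm c' + 1"] by simp
  show "lp_norm (\<lambda>l. c l + c' l) \<le> lp_norm c + lp_norm c'"
  proof (rule field_le_epsilon)
    fix e :: real assume "e > 0"
    then show "lp_norm (\<lambda>l. c l + c' l) \<le> lp_norm c + lp_norm c' + e"
      using lp_add_aux(2)[OF assms, of "lp_norm c + e / 2" "lp_norm c' + e / 2"] by simp
  qed
qed

lemma lp_diff:
  assumes "lp c" "lp c'"
  shows "lp (\<lambda>l. c l - c' l)"
  using lp_add(1)[OF assms(1) lp_scale(1)[OF assms(2), of "-1"]] by simp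

text \<open>Coordinates converge, and the Cauchy bound survives the limit because it can be checked
  on finite index sets, where coordinatewise convergence suffices.\<close>

lemma lp_complete:
  assumes lp: "\<And>k::nat. lp (c k)"
    and Cauchy: "\<And>e. e > 0 \<Longrightarrow> \<exists>K. \<forall>m\<ge>K. \<forall>n\<ge>K. lp_norm (\<lambda>l. c m l - c n l) < e"
  obtains c' where "lp c'" "(\<lambda>k. lp_norm (\<lambda>l. c k l - c' l)) \<longlonglongrightarrow> 0"
proof -
  have conv: "convergent (\<lambda>k. c k l)" if l: "l \<ge> 1" for l
  proof (intro Cauchy_convergent CauchyI)
    fix e :: real assume "e > 0"
    \<comment> \<open>This tolerance compensates the division by \<open>w l powr (1 / p)\<close> in
      \<open>lp_coord_le\<close>.\<close>
    then have "e * w l powr (1 / p) > 0" using w[OF l] by simp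
    from Cauchy[OF this] obtain K where
      K: "\<And>m n. m \<ge> K \<Longrightarrow> n \<ge> K \<Longrightarrow> lp_norm (\<lambda>l. c m l - c n l) < e * w l powr (1 / p)" by blast
    have "norm (c m l - c n l) < e" if "m \<ge> K" "n \<ge> K" for m n
    proof -
      have "\<bar>c m l - c n l\<bar> \<le> lp_norm (\<lambda>l. c m l - c n l) / w l powr (1 / p)"
        by (rule lp_coord_le[OF lp_diff[OF lp lp] l])
      also have "\<dots> < e" using K[OF that] w[OF l] by (simp add: field_simps)
      finally show ?thesis by simp
    qed
    then show "\<exists>K. \<forall>m\<ge>K. \<forall>n\<ge>K. norm (c m l - c n l) < e" by blast
  qed
  define c' where "c' l = lim (\<lambda>k. c k l)" for l
  have lim: "(\<lambda>k. c k l) \<longlonglongrightarrow> c' l" if "l \<ge> 1" for l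
    using conv[OF that] by (simp add: c'_def convergent_LIMSEQ_iff)
  have close: "\<exists>K. \<forall>m\<ge>K. lp (\<lambda>l. c m l - c' l) \<and> lp_norm (\<lambda>l. c m l - c' l) \<le> e" if e: "e > 0" for e
  proof -
    from Cauchy[OF e] obtain K where
      K: "\<And>m n. m \<ge> K \<Longrightarrow> n \<ge> K \<Longrightarrow> lp_norm (\<lambda>l. c m l - c n l) < e" by blast
    have "lp (\<lambda>l. c m l - c' l) \<and> lp_norm (\<lambda>l. c m l - c' l) \<le> e" if m: "m \<ge> K" for m
    proof -
      have "(\<Sum>l\<in>F. w l * \<bar>c m l - c' l\<bar> powr p) \<le> e powr p" if F: "finite F" "F \<subseteq> {1..}" for F
      proof (rule tendsto_upperbound)
        show "(\<lambda>n. \<Sum>l\<in>F. w l * \<bar>c m l - c n l\<bar> powr p) \<longlonglongrightarrow> (\<Sum>l\<in>F. w l * \<bar>c m l - c' l\<bar> powr p)"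
          using F p by (intro tendsto_intros tendsto_powr' lim) auto
        have "(\<Sum>l\<in>F. w l * \<bar>c m l - c n l\<bar> powr p) \<le> e powr p" if "n \<ge> K" for n
          by (rule order_trans[OF lp_finite_sum_le[OF lp_diff[OF lp lp] F]])
            (use K[OF m that] p in \<open>auto intro!: powr_mono2\<close>)
        then show "\<forall>\<^sub>F n in sequentially. (\<Sum>l\<in>F. w l * \<bar>c m l - c n l\<bar> powr p) \<le> e powr p"
          by (auto simp: eventually_sequentially)
      qed simp
      from lpI[OF this] e show ?thesis by simp
    qed
    then show ?thesis by blast
  qed
  obtain m where "lp (\<lambda>l. c m l - c' l)" using close[of 1] by auto
  \<comment> \<open>The limit is recovered as \<open>c m - (c m - c')\<close>.\<close>
  from lp_diff[OF lp[of m] this] have "lp c'" by simp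
  moreover have "(\<lambda>k. lp_norm (\<lambda>l. c k l - c' l)) \<longlonglongrightarrow> 0"
  proof (rule LIMSEQ_I)
    fix e :: real assume "e > 0"
    then show "\<exists>K. \<forall>k\<ge>K. norm (lp_norm (\<lambda>l. c k l - c' l) - 0) < e"
      using close[of "e / 2"] by fastforce
  qed
  ultimately show ?thesis using that by blast
qed

lemma lp_tail:
  assumes "lp c"
  shows "(\<lambda>n. lp_norm (\<lambda>l. c l - (if l \<le> n then c l else 0))) \<longlonglongrightarrow> 0"
proof -
  define f where "f l = w l * \<bar>c l\<bar> powr p" for l
  have f: "f summable_on {1..}" using assms unfolding lp_def f_def .
  have le: "sum f {1..n} \<le> infsum f {1..}" for n
    using term_nonneg[of _ c] by (intro finite_sum_le_infsum f) (auto simp: f_def)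
  have tail: "(\<Sum>\<^sub>\<infinity>l\<in>{1..}. w l * \<bar>c l - (if l \<le> n then c l else 0)\<bar> powr p)
      = infsum f {1..} - sum f {1..n}" for n
  proof -
    have "(\<Sum>\<^sub>\<infinity>l\<in>{1..}. w l * \<bar>c l - (if l \<le> n then c l else 0)\<bar> powr p) = infsum f ({1..} - {1..n})"
      by (intro infsum_cong_neutral) (auto simp: f_def)
    also have "\<dots> = infsum f {1..} - infsum f {1..n}"
      using f by (intro infsum_Diff) auto
    finally show ?thesis by simp
  qed
  have "(\<lambda>n. infsum f {1..} - sum f {1..n}) \<longlonglongrightarrow> infsum f {1..} - infsum f {1..}"
    by (intro tendsto_intros sum_tendsto_infsum f)
  then have "(\<lambda>n. (infsum f {1..} - sum f {1..n}) powr (1 / p)) \<longlonglongrightarrow> 0 powr (1 / p)"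
    \<comment> \<open>The base tends to 0, where the limit rule for \<open>powr\<close> wants a
      positive exponent and a nonnegative base; \<open>le\<close> gives the latter.\<close>
    using p le by (intro tendsto_powr' tendsto_const disjI2 conjI always_eventually allI) auto
  then show ?thesis unfolding lp_norm_def tail by simp
qed

end

section \<open>Measurability in separable normed spaces\<close>

text \<open>The axioms of \<open>Metric_space\<close> for the induced distance ask for nonnegativity and symmetry also
  outside the carrier.\<close>

locale normed_carrier =
  fixes Y :: "'y::real_vector set" and N :: "'y \<Rightarrow> real"
  assumes normed: "normed_space_on Y N"
    and N_nonneg [simp]: "0 \<le> N x"
    and N_minus: "N (- x) = N x"
begin

lemma subspace: "subspace Y" and N_eq_0: "x \<in> Y \<Longrightarrow> N x = 0 \<longleftrightarrow> x = 0"
  and N_triangle: "x \<in> Y \<Longrightarrow> y \<in> Y \<Longrightarrow> N (x + y) \<le> N x + N y"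
  using normed by (auto simp: normed_space_on_def)

sublocale Metric_space Y "\<lambda>x y. N (x - y)"
proof
  show "N (x - y) = N (y - x)" for x y
    using N_minus[of "y - x"] by simp
  show "N (x - z) \<le> N (x - y) + N (y - z)" if "x \<in> Y" "y \<in> Y" "z \<in> Y" for x y z
    using N_triangle[of "x - y" "y - z"] that subspace by (simp add: subspace_diff)
qed (use N_eq_0 subspace in \<open>auto simp: subspace_diff\<close>)

lemma space_borel_on: "space (borel_on Y N) = Y"
  and sets_borel_on: "sets (borel_on Y N) = sigma_sets Y {G. openin (norm_topology Y N) G}"
proof -
  have "{G. openin (norm_topology Y N) G} \<subseteq> Pow Y"
    by (auto simp: norm_topology_def openin_mtopology)
  then show "space (borel_on Y N) = Y"
    "sets (borel_on Y N) = sigma_sets Y {G. openin (norm_topology Y N) G}"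
    by (auto simp: borel_on_def space_measure_of sets_measure_of)
qed

lemma measurable_borel_on_openI:
  assumes "f \<in> space M \<rightarrow> Y"
    and "\<And>G. openin (norm_topology Y N) G \<Longrightarrow> f -` G \<inter> space M \<in> sets M"
  shows "f \<in> M \<rightarrow>\<^sub>M borel_on Y N"
  unfolding borel_on_def
  by (rule measurable_measure_of)
    (use assms in \<open>auto simp: norm_topology_def openin_mtopology\<close>)

text \<open>Every open set is the union of the countably many balls with centre in a dense sequence and
  rational radius that it contains.\<close>

lemma measurable_borel_onI:
  assumes sep: "separable_space (norm_topology Y N)"
    and f: "f \<in> space M \<rightarrow> Y"
    and dist: "\<And>y. y \<in> Y \<Longrightarrow> (\<lambda>\<omega>. N (y - f \<omega>)) \<in> borel_measurable M"
  shows "f \<in> M \<rightarrow>\<^sub>M borel_on Y N"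
proof (rule measurable_borel_on_openI[OF f])
  fix G assume G: "openin (norm_topology Y N) G"
  obtain D where D: "countable D" "D \<subseteq> Y" "mtopology closure_of D = Y"
    using sep by (auto simp: separable_space_def norm_topology_def)
  define I where "I = {(d, q). d \<in> D \<and> q \<in> \<rat> \<and> mball d q \<subseteq> G}"
  have "countable I"
    by (rule countable_subset[of _ "D \<times> \<rat>"]) (auto simp: I_def countable_rat intro!: countable_SIGMA D)
  have "G \<subseteq> (\<Union>(d, q)\<in>I. mball d q)"
  proof
    fix x assume x: "x \<in> G"
    then obtain r where r: "r > 0" "mball x r \<subseteq> G" and xY: "x \<in> Y"
      using G unfolding norm_topology_def openin_mtopology by blast
    \<comment> \<open>Half the radius leaves room to move the centre: a ball of radius q about a
      point within q of x stays inside \<open>mball x r\<close>.\<close>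
    obtain q where q: "q \<in> \<rat>" "0 < q" "q < r / 2"
      using Rats_dense_in_real[of 0 "r / 2"] r by auto
    have "x \<in> mtopology closure_of D" using D xY by simp
    then obtain d where d: "d \<in> D" "d \<in> mball x q"
      using q by (auto simp: metric_closure_of)
    have "mball d q \<subseteq> mball x r"
      using d q by (intro mball_subset) (auto simp: commute)
    with r d q have "(d, q) \<in> I" "x \<in> mball d q"
      by (auto simp: I_def commute)
    then show "x \<in> (\<Union>(d, q)\<in>I. mball d q)" by blast
  qed
  then have "f -` G \<inter> space M = (\<Union>(d, q)\<in>I. {\<omega> \<in> space M. N (d - f \<omega>) < q})"
  proof (intro set_eqI iffI)
    fix \<omega> assume *: "\<omega> \<in> f -` G \<inter> space M"
    then obtain i where "i \<in> I" "f \<omega> \<in> (case i of (d, q) \<Rightarrow> mball d q)"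
      using \<open>G \<subseteq> _\<close> by blast
    with * show "\<omega> \<in> (\<Union>(d, q)\<in>I. {\<omega> \<in> space M. N (d - f \<omega>) < q})"
      by (auto intro!: bexI[of _ i])
  next
    fix \<omega> assume "\<omega> \<in> (\<Union>(d, q)\<in>I. {\<omega> \<in> space M. N (d - f \<omega>) < q})"
    then obtain d q where *: "(d, q) \<in> I" "\<omega> \<in> space M" "N (d - f \<omega>) < q" by blast
    then have "f \<omega> \<in> mball d q" using f D(2) by (auto simp: I_def)
    with * show "\<omega> \<in> f -` G \<inter> space M" by (auto simp: I_def)
  qed
  also have "\<dots> \<in> sets M"
  proof (intro sets.countable_UN'' \<open>countable I\<close>)
    fix i assume "i \<in> I"
    then have [measurable]: "(\<lambda>\<omega>. N (fst i - f \<omega>)) \<in> borel_measurable M"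
      using D by (intro dist) (auto simp: I_def)
    show "(case i of (d, q) \<Rightarrow> {\<omega> \<in> space M. N (d - f \<omega>) < q}) \<in> sets M"
      by (simp add: case_prod_beta)
  qed
  finally show "f -` G \<inter> space M \<in> sets M" .
qed

end

section \<open>Lipschitz maps and bounded functionals\<close>

lemma measurable_borel_on_Lipschitz:
  assumes "normed_carrier Y N" "normed_carrier Z K"
    and g: "g ` Y \<subseteq> Z"
    and lip: "\<And>x y. x \<in> Y \<Longrightarrow> y \<in> Y \<Longrightarrow> K (g x - g y) \<le> C * N (x - y)"
  shows "g \<in> borel_on Y N \<rightarrow>\<^sub>M borel_on Z K"
proof -
  interpret Y: normed_carrier Y N by fact
  interpret Z: normed_carrier Z K by fact
  show ?thesis
  proof (rule Z.measurable_borel_on_openI)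
    show "g \<in> space (borel_on Y N) \<rightarrow> Z" using g by (auto simp: Y.space_borel_on)
    fix G assume G: "openin (norm_topology Z K) G"
    have "\<exists>r>0. Y.mball x r \<subseteq> g -` G \<inter> Y" if x: "x \<in> Y" "g x \<in> G" for x
    proof -
      obtain r where r: "r > 0" "Z.mball (g x) r \<subseteq> G"
        using G x by (auto simp: norm_topology_def Z.openin_mtopology)
      \<comment> \<open>\<open>C\<close> may be 0 or negative, so \<open>\<bar>C\<bar> + 1\<close>
        serves as a positive Lipschitz constant.\<close>
      have "g y \<in> G" if y: "y \<in> Y" "N (x - y) < r / (\<bar>C\<bar> + 1)" for y
      proof -
        have "K (g x - g y) \<le> C * N (x - y)" using x y by (intro lip)
        also have "\<dots> \<le> (\<bar>C\<bar> + 1) * N (x - y)" by (intro mult_right_mono) auto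
        also have "\<dots> < r" using y(2) by (simp add: field_simps)
        finally have "g y \<in> Z.mball (g x) r" using x y g by auto
        then show ?thesis using r(2) by blast
      qed
      then show ?thesis using r(1) x by (intro exI[of _ "r / (\<bar>C\<bar> + 1)"]) auto
    qed
    then have "openin (norm_topology Y N) (g -` G \<inter> Y)"
      by (auto simp: norm_topology_def Y.openin_mtopology)
    then show "g -` G \<inter> space (borel_on Y N) \<in> sets (borel_on Y N)"
      by (auto simp: Y.space_borel_on Y.sets_borel_on)
  qed
qed

lemma bounded_linear_on_Lipschitz:
  fixes T :: "'y::real_vector \<Rightarrow> 'z::real_vector"
  assumes "bounded_linear_on Y N K T" "subspace Y"
  shows "\<exists>C. \<forall>x\<in>Y. \<forall>y\<in>Y. K (T x - T y) \<le> C * N (x - y)"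
proof -
  have add: "\<And>x y. x \<in> Y \<Longrightarrow> y \<in> Y \<Longrightarrow> T (x + y) = T x + T y"
    using assms(1) unfolding bounded_linear_on_def by blast
  obtain C where C: "\<And>x. x \<in> Y \<Longrightarrow> K (T x) \<le> C * N x"
    using assms(1) unfolding bounded_linear_on_def by blast
  have diff: "T x - T y = T (x - y)" if "x \<in> Y" "y \<in> Y" for x y
  proof -
    have "T x = T (x - y + y)" by simp
    also have "\<dots> = T (x - y) + T y" using that assms(2) by (intro add) (auto simp: subspace_diff)
    finally show ?thesis by simp
  qed
  show ?thesis
    using C diff assms(2) by (intro exI[of _ C]) (simp add: subspace_diff)
qed

lemma normed_carrier_abs: "normed_carrier (UNIV :: real set) abs"
  by unfold_locales (auto simp: normed_space_on_def abs_mult)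

text \<open>Lets bounded functionals be treated as Lipschitz maps between normed carriers.\<close>

lemma borel_on_real: "borel_on (UNIV :: real set) abs = borel"
proof -
  have "norm_topology (UNIV :: real set) abs = Met_TC.mtopology"
    by (simp add: norm_topology_def flip: dist_real_def)
  then show ?thesis by (simp add: borel_on_def borel_def)
qed

lemma dual_on_measurable:
  assumes "normed_carrier Y N" "y' \<in> dual_on Y N"
  shows "y' \<in> borel_measurable (borel_on Y N)"
proof -
  interpret normed_carrier Y N by fact
  have "bounded_linear_on Y N abs y'"
    using assms(2) by (simp add: dual_on_def)
  from bounded_linear_on_Lipschitz[OF this subspace]
  obtain C where "\<And>x y. x \<in> Y \<Longrightarrow> y \<in> Y \<Longrightarrow> \<bar>y' x - y' y\<bar> \<le> C * N (x - y)" by blast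
  from measurable_borel_on_Lipschitz[OF assms(1) normed_carrier_abs _ this]
  show ?thesis by (simp add: borel_on_real)
qed

text \<open>Integrals of bounded continuous functions converge by dominated convergence.\<close>

lemma (in prob_space) weak_conv_m_distr_pointwise:
  fixes f :: "nat \<Rightarrow> 'a \<Rightarrow> real"
  assumes f[measurable]: "\<And>n. f n \<in> borel_measurable M" and g[measurable]: "g \<in> borel_measurable M"
    and lim: "\<And>\<omega>. \<omega> \<in> space M \<Longrightarrow> (\<lambda>n. f n \<omega>) \<longlonglongrightarrow> g \<omega>"
  shows "weak_conv_m (\<lambda>n. distr M borel (f n)) (distr M borel g)"
proof (rule integral_bdd_continuous_conv_imp_weak_conv)
  show "real_distribution (distr M borel (f n))" for n
    using f by (intro real_distribution_distr)
  show "real_distribution (distr M borel g)"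
    using g by (intro real_distribution_distr)
  fix h :: "real \<Rightarrow> real" assume h: "\<And>x. isCont h x" "\<And>x. \<bar>h x\<bar> \<le> 1"
  have [measurable]: "h \<in> borel_measurable borel"
    using h(1) by (intro borel_measurable_continuous_onI continuous_at_imp_continuous_on) auto
  have "(\<lambda>n. \<integral>\<omega>. h (f n \<omega>) \<partial>M) \<longlonglongrightarrow> (\<integral>\<omega>. h (g \<omega>) \<partial>M)"
  proof (rule integral_dominated_convergence[where w = "\<lambda>_. 1"])
    show "AE \<omega> in M. (\<lambda>n. h (f n \<omega>)) \<longlonglongrightarrow> h (g \<omega>)"
      using isCont_tendsto_compose[OF h(1) lim] by (intro AE_I2)
  qed (use h(2) in simp_all)
  then show "(\<lambda>n. integral\<^sup>L (distr M borel (f n)) h) \<longlonglongrightarrow> integral\<^sup>L (distr M borel g) h"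
    by (simp add: integral_distr)
qed

section \<open>Besov spaces\<close>

lemma summable_on_finite_support:
  fixes f :: "'a \<Rightarrow> real"
  assumes "finite {x \<in> A. f x \<noteq> 0}"
  shows "f summable_on A"
proof -
  have "f summable_on {x \<in> A. f x \<noteq> 0} \<longleftrightarrow> f summable_on A"
    by (rule summable_on_cong_neutral) auto
  with summable_on_finite[OF assms, of f] show ?thesis by blast
qed

lemma torus_L2_integrable_mult:
  assumes "f \<in> torus_L2" "g \<in> torus_L2"
  shows "integrable torus (\<lambda>x. f x * g x)"
proof (rule Bochner_Integration.integrable_bound)
  show "integrable torus (\<lambda>x. (f x)\<^sup>2 + (g x)\<^sup>2)"
    using assms by (simp add: torus_L2_def)
  show "(\<lambda>x. f x * g x) \<in> borel_measurable torus"
    using assms by (auto simp: torus_L2_def)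
  have "\<bar>a * b\<bar> \<le> a\<^sup>2 + b\<^sup>2" for a b :: real
  proof -
    have "2 * (\<bar>a\<bar> * \<bar>b\<bar>) \<le> a\<^sup>2 + b\<^sup>2"
      using sum_squares_bound[of "\<bar>a\<bar>" "\<bar>b\<bar>"] by (simp add: mult.assoc)
    moreover have "0 \<le> \<bar>a\<bar> * \<bar>b\<bar>" by simp
    ultimately show ?thesis unfolding abs_mult by linarith
  qed
  then show "AE x in torus. norm (f x * g x) \<le> norm ((f x)\<^sup>2 + (g x)\<^sup>2)"
    by simp
qed

text \<open>An element of the span is built from one multiple of a basis function at a time, and by
  orthonormality each step adds at most one index. Hence the sum defining
  \<open>wavelet_series\<close> is finite for arbitrary coefficients, and \<open>infsum\<close>,
  which is 0 on divergent families, is additive there.\<close>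

lemma finite_torus_inner_span:
  assumes orth: "torus_orthonormal \<psi>" and f: "f \<in> span (\<psi> ` {1..})"
  shows "finite {l. 1 \<le> l \<and> torus_inner (\<psi> l) f \<noteq> 0}"
proof -
  \<comment> \<open>Integrability is carried through the induction because
    \<open>torus_inner\<close> is additive only where the products are integrable.\<close>
  have "(\<forall>l\<ge>1. integrable torus (\<lambda>x. \<psi> l x * f x)) \<and> finite {l. 1 \<le> l \<and> torus_inner (\<psi> l) f \<noteq> 0}"
    using f
  proof (induction rule: span_induct_alt)
    case base
    then show ?case by (simp add: torus_inner_def)
  next
    case (step a g h)
    then obtain k where k: "k \<ge> 1" "g = \<psi> k" by auto
    have int: "integrable torus (\<lambda>x. \<psi> l x * g x)" if "l \<ge> 1" for l
      using orth that k by (intro torus_L2_integrable_mult) (auto simp: torus_orthonormal_def)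
    have "torus_inner (\<psi> l) (a *\<^sub>R g + h) = a * torus_inner (\<psi> l) g + torus_inner (\<psi> l) h"
      if "l \<ge> 1" for l
    proof -
      have "torus_inner (\<psi> l) (a *\<^sub>R g + h) = (LINT x|torus. a * (\<psi> l x * g x) + \<psi> l x * h x)"
        by (simp add: torus_inner_def algebra_simps)
      then show ?thesis using int[OF that] step that by (simp add: torus_inner_def)
    qed
    then have "{l. 1 \<le> l \<and> torus_inner (\<psi> l) (a *\<^sub>R g + h) \<noteq> 0} \<subseteq>
        insert k {l. 1 \<le> l \<and> torus_inner (\<psi> l) h \<noteq> 0}"
      using orth k by (auto simp: torus_orthonormal_def)
    moreover have "integrable torus (\<lambda>x. \<psi> l x * (a *\<^sub>R g + h) x)" if "l \<ge> 1" for l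
    proof -
      have "integrable torus (\<lambda>x. a * (\<psi> l x * g x) + \<psi> l x * h x)"
        using int[OF that] step that by simp
      then show ?thesis by (simp add: algebra_simps)
    qed
    ultimately show ?case using step by (metis (no_types, lifting) finite_insert finite_subset)
  qed
  then show ?thesis by blast
qed

lemma wavelet_series_cong:
  assumes "\<And>l. l \<ge> 1 \<Longrightarrow> c l = c' l"
  shows "wavelet_series \<psi> c = wavelet_series \<psi> c'"
proof -
  have "(\<Sum>\<^sub>\<infinity>l\<in>{1..}. c l * torus_inner (\<psi> l) f) = (\<Sum>\<^sub>\<infinity>l\<in>{1..}. c' l * torus_inner (\<psi> l) f)" for f
    by (intro infsum_cong) (simp add: assms)
  then show ?thesis by (simp add: wavelet_series_def fun_eq_iff)
qed

lemma wavelet_series_zero: "wavelet_series \<psi> (\<lambda>_. 0) = 0"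
  by (simp add: wavelet_series_def fun_eq_iff)

lemma wavelet_series_scale:
  "wavelet_series \<psi> (\<lambda>l. a * c l) = a *\<^sub>R wavelet_series \<psi> c"
  by (simp add: wavelet_series_def fun_eq_iff mult.assoc infsum_cmult_right')

lemma wavelet_series_add:
  assumes "torus_orthonormal \<psi>"
  shows "wavelet_series \<psi> (\<lambda>l. c l + c' l) = wavelet_series \<psi> c + wavelet_series \<psi> c'"
proof -
  have "(\<lambda>l. c l * torus_inner (\<psi> l) f) summable_on {1..}" if "f \<in> span (\<psi> ` {1..})" for c f
  proof -
    have "finite {l. 1 \<le> l \<and> torus_inner (\<psi> l) f \<noteq> 0}"
      by (rule finite_torus_inner_span[OF assms that])
    then show ?thesis
      by (rule summable_on_finite_support[OF finite_subset[rotated]]) auto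
  qed
  then have "(\<Sum>\<^sub>\<infinity>l\<in>{1..}. (c l + c' l) * torus_inner (\<psi> l) f) =
      (\<Sum>\<^sub>\<infinity>l\<in>{1..}. c l * torus_inner (\<psi> l) f) + (\<Sum>\<^sub>\<infinity>l\<in>{1..}. c' l * torus_inner (\<psi> l) f)"
    if "f \<in> span (\<psi> ` {1..})" for f
    unfolding distrib_right using that by (intro infsum_add) blast+
  then show ?thesis by (simp add: wavelet_series_def fun_eq_iff)
qed

abbreviation besov_weight :: "nat \<Rightarrow> real \<Rightarrow> real \<Rightarrow> nat \<Rightarrow> real" where
  "besov_weight d p \<sigma> l \<equiv> real l powr (p * \<sigma> / real d + p / 2 - 1)"

locale besov =
  fixes \<psi> :: "nat \<Rightarrow> real^'d \<Rightarrow> real" and p \<sigma> :: real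
  assumes p_ge: "1 \<le> p" and orth: "torus_orthonormal \<psi>"
begin

abbreviation "Y \<equiv> besov_space \<psi> p \<sigma>"
abbreviation "N \<equiv> besov_norm \<psi> p \<sigma>"
abbreviation "coef \<equiv> wavelet_coeff \<psi>"
abbreviation "series \<equiv> wavelet_series \<psi>"
abbreviation "trunc \<equiv> wavelet_truncation \<psi>"

sublocale weighted_lp "besov_weight CARD('d) p \<sigma>" p
  by standard (use p_ge in auto)

text \<open>\<open>coef u 0\<close> is the value at \<open>\<psi> 0\<close>, which lies outside the
  numbering of the basis, so coefficient sequences are compared from 1 on only.\<close>

lemma lp_cong: "(\<And>l. l \<ge> 1 \<Longrightarrow> c l = c' l) \<Longrightarrow> lp c = lp c'"
  unfolding lp_def by (intro summable_on_cong) simp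

lemma lp_norm_cong: "(\<And>l. l \<ge> 1 \<Longrightarrow> c l = c' l) \<Longrightarrow> lp_norm c = lp_norm c'"
  unfolding lp_norm_def by (intro arg_cong[where f = "\<lambda>x. x powr _"] infsum_cong) simp

lemma besov_norm_eq: "N u = lp_norm (coef u)"
  by (simp add: besov_norm_def lp_norm_def besov_term_def)

lemma coeff_linear:
  "coef (u + v) l = coef u l + coef v l" "coef (u - v) l = coef u l - coef v l"
  "coef (- u) l = - coef u l" "coef (a *\<^sub>R u) l = a * coef u l" "coef 0 l = 0"
  by (simp_all add: wavelet_coeff_def)

lemma coeff_series [simp]: "l \<ge> 1 \<Longrightarrow> coef (series c) l = c l"
  by (rule wavelet_coeff_series[OF orth])

lemma besov_space_eq: "Y = series ` Collect lp"
proof -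
  have "besov_term CARD('d) p \<sigma> c summable_on {1..} \<longleftrightarrow> lp c" for c
    unfolding lp_def besov_term_def[abs_def] ..
  then show ?thesis unfolding besov_space_def by blast
qed

lemma series_mem: "lp c \<Longrightarrow> series c \<in> Y"
  by (simp add: besov_space_eq)

text \<open>Together with \<open>series_coeff\<close> this identifies \<open>Y\<close> with the
  weighted sequence space modulo the entry at 0, which carries its results over.\<close>

lemma lp_coeff: "u \<in> Y \<Longrightarrow> lp (coef u)"
proof -
  assume "u \<in> Y"
  then obtain c where "lp c" "u = series c" unfolding besov_space_eq by blast
  moreover have "lp (coef (series c)) = lp c" by (rule lp_cong) simp
  ultimately show ?thesis by simp
qed

lemma series_coeff: "u \<in> Y \<Longrightarrow> series (coef u) = u"
  unfolding besov_space_eq by (auto intro!: wavelet_series_cong)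

lemma besov_normed_carrier: "normed_carrier Y N"
proof
  have add: "u + v \<in> Y" and add_le: "N (u + v) \<le> N u + N v" if "u \<in> Y" "v \<in> Y" for u v
  proof -
    have "u + v = series (\<lambda>l. coef u l + coef v l)"
      using that by (simp add: wavelet_series_add[OF orth] series_coeff)
    then show "u + v \<in> Y" using lp_add[OF lp_coeff lp_coeff] that by (auto intro: series_mem)
    show "N (u + v) \<le> N u + N v"
      using lp_add(2)[OF lp_coeff lp_coeff] that by (simp add: besov_norm_eq coeff_linear[abs_def])
  qed
  have scale: "a *\<^sub>R u \<in> Y" and scale_eq: "N (a *\<^sub>R u) = \<bar>a\<bar> * N u" if "u \<in> Y" for a u
  proof -
    have "a *\<^sub>R u = series (\<lambda>l. a * coef u l)"
      using that by (simp add: wavelet_series_scale series_coeff)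
    then show "a *\<^sub>R u \<in> Y" using lp_scale[OF lp_coeff] that by (auto intro: series_mem)
    show "N (a *\<^sub>R u) = \<bar>a\<bar> * N u"
      using lp_scale(2)[OF lp_coeff] that by (simp add: besov_norm_eq coeff_linear[abs_def])
  qed
  have zero: "0 \<in> Y" using series_mem[OF lp_zero(1)] by (simp add: wavelet_series_zero)
  have N_0: "N 0 = 0" using lp_zero(2) by (simp add: besov_norm_eq coeff_linear[abs_def])
  have "u = 0" if "u \<in> Y" "N u = 0" for u
  proof -
    have "series (coef u) = series (\<lambda>_. 0)"
      using that lp_norm_eq_0D[OF lp_coeff] by (intro wavelet_series_cong) (simp add: besov_norm_eq)
    then show ?thesis using that by (simp add: series_coeff wavelet_series_zero)
  qed
  moreover show "0 \<le> N u" for u by (simp add: besov_norm_eq)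
  ultimately show "normed_space_on Y N"
    unfolding normed_space_on_def
    using add add_le scale scale_eq zero N_0 by (auto simp: subspace_def)
  show "N (- u) = N u" for u
    by (simp add: besov_norm_eq coeff_linear[abs_def] lp_norm_def)
qed

sublocale normed_carrier Y N
  by (rule besov_normed_carrier)

section \<open>Truncation operators\<close>

lemma lp_truncate: "lp c \<Longrightarrow> lp (\<lambda>l. if l \<le> n then c l else 0)"
  by (erule lp_bounded_by) simp

lemma trunc_mem: "u \<in> Y \<Longrightarrow> trunc n u \<in> Y"
  unfolding wavelet_truncation_def by (intro series_mem lp_truncate lp_coeff)

lemma coeff_trunc: "l \<ge> 1 \<Longrightarrow> coef (trunc n u) l = (if l \<le> n then coef u l else 0)"
  by (simp add: wavelet_truncation_def)

text \<open>Holds for all functionals, since a coefficient is an evaluation and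
  \<open>wavelet_series\<close> is additive for every coefficient sequence.\<close>

lemma trunc_add: "trunc n (u + v) = trunc n u + trunc n v"
  unfolding wavelet_truncation_def
  by (subst wavelet_series_add[OF orth, symmetric])
    (auto intro!: wavelet_series_cong simp: coeff_linear)

lemma trunc_scale: "trunc n (a *\<^sub>R u) = a *\<^sub>R trunc n u"
  unfolding wavelet_truncation_def
  by (subst wavelet_series_scale[symmetric]) (auto intro!: wavelet_series_cong simp: coeff_linear)

lemma norm_trunc_le: "u \<in> Y \<Longrightarrow> N (trunc n u) \<le> N u"
proof -
  assume "u \<in> Y"
  have "N (trunc n u) = lp_norm (\<lambda>l. if l \<le> n then coef u l else 0)"
    unfolding besov_norm_eq by (intro lp_norm_cong) (simp add: coeff_trunc)
  also have "\<dots> \<le> N u"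
    unfolding besov_norm_eq by (rule lp_bounded_by(2)[OF lp_coeff[OF \<open>u \<in> Y\<close>]]) simp
  finally show ?thesis .
qed

lemma trunc_bounded_operator: "bounded_operator_on Y N (trunc n)"
  unfolding bounded_operator_on_def bounded_linear_on_def
  by (auto simp: trunc_mem trunc_add trunc_scale intro!: exI[of _ 1] norm_trunc_le)

lemma trunc_Lipschitz:
  assumes "u \<in> Y" "v \<in> Y"
  shows "N (trunc n u - trunc n v) \<le> N (u - v)"
proof -
  have "trunc n u = trunc n (u - v) + trunc n v" by (simp flip: trunc_add)
  then show ?thesis using assms norm_trunc_le[of "u - v" n] subspace by (simp add: subspace_diff)
qed

lemma norm_trunc_diff_tendsto:
  assumes "u \<in> Y"
  shows "(\<lambda>n. N (trunc n u - u)) \<longlonglongrightarrow> 0"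
proof -
  have "N (trunc n u - u) = lp_norm (\<lambda>l. coef u l - (if l \<le> n then coef u l else 0))" for n
    by (subst commute, unfold besov_norm_eq, intro lp_norm_cong)
      (simp add: coeff_linear coeff_trunc)
  then show ?thesis using lp_tail[OF lp_coeff[OF assms]] by simp
qed

lemma trunc_limitin:
  assumes "u \<in> Y"
  shows "limitin (norm_topology Y N) (\<lambda>n. trunc n u) u sequentially"
  unfolding norm_topology_def limitin_metric_dist_null
  using assms norm_trunc_diff_tendsto by (simp add: trunc_mem)

section \<open>Completeness and separability of the Besov space\<close>

lemma besov_mcomplete: mcomplete
  unfolding mcomplete_def
proof (intro allI impI)
  fix u :: "nat \<Rightarrow> 'd genfun" assume u: "MCauchy u"
  then have mem: "u k \<in> Y" for k by (auto simp: MCauchy_def)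
  have diff: "lp_norm (\<lambda>l. coef (u m) l - coef (u n) l) = N (u m - u n)" for m n
    by (simp add: besov_norm_eq coeff_linear[abs_def])
  have "\<exists>K. \<forall>m\<ge>K. \<forall>n\<ge>K. lp_norm (\<lambda>l. coef (u m) l - coef (u n) l) < e" if "e > 0" for e
    unfolding diff using u that by (auto simp: MCauchy_def)
  from lp_complete[OF lp_coeff[OF mem] this] obtain c where
    c: "lp c" "(\<lambda>k. lp_norm (\<lambda>l. coef (u k) l - c l)) \<longlonglongrightarrow> 0" by blast
  have "lp_norm (\<lambda>l. coef (u k) l - c l) = N (u k - series c)" for k
    unfolding besov_norm_eq by (intro lp_norm_cong) (simp add: coeff_linear)
  then have "limitin mtopology u (series c) sequentially"
    using c mem by (simp add: limitin_metric_dist_null series_mem)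
  then show "\<exists>x. limitin mtopology u x sequentially" by blast
qed

text \<open>The dense set consists of the series with finitely many nonzero, rational coefficients,
  made countable by coding them as lists. Truncating u costs less than \<open>e / 2\<close>, and
  rounding the remaining coefficients at most \<open>e / 2\<close>.\<close>

lemma besov_separable: "separable_space (norm_topology Y N)"
proof -
  define q :: "rat list \<Rightarrow> nat \<Rightarrow> real" where
    "q xs l = (if l < length xs then of_rat (xs ! l) else 0)" for xs l
  have lp_q: "lp (q xs)" for xs
    unfolding lp_def
    by (rule summable_on_finite_support, rule finite_subset[of _ "{..<length xs}"])
      (auto simp: q_def)
  define D where "D = range (\<lambda>xs. series (q xs))"
  have "countable D" by (simp add: D_def)
  have DY: "D \<subseteq> Y" using lp_q by (auto simp: D_def intro: series_mem)
  have "\<exists>d\<in>D. N (u - d) < e" if u: "u \<in> Y" and e: "e > 0" for u e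
  proof -
    have "\<forall>\<^sub>F n in sequentially. N (trunc n u - u) < e / 2"
      using norm_trunc_diff_tendsto[OF u] e by (intro order_tendstoD) auto
    then obtain n where n: "N (trunc n u - u) < e / 2" by (auto simp: eventually_sequentially)
    \<comment> \<open>Solves weight times \<open>\<delta> l powr p\<close> equal to
      \<open>(e / 2) powr p / (n + 1)\<close>, an equal share for each index up to n. Counting 0 as
      well keeps the denominator positive for \<open>n = 0\<close>.\<close>
    define \<delta> where "\<delta> l = ((e / 2) powr p / ((real n + 1) * besov_weight CARD('d) p \<sigma> l)) powr (1 / p)" for l
    have \<delta>: "\<delta> l > 0" if "l \<ge> 1" for l using that e w[of l] by (simp add: \<delta>_def)
    have "\<exists>r. \<bar>coef u l - of_rat r\<bar> \<le> \<delta> l" if l: "l \<ge> 1" for l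
    proof -
      obtain r where "coef u l < of_rat r" "of_rat r < coef u l + \<delta> l"
        using of_rat_dense[of "coef u l" "coef u l + \<delta> l"] \<delta>[OF l] by auto
      then show ?thesis by (intro exI[of _ r]) linarith
    qed
    then obtain r where r: "\<And>l. l \<ge> 1 \<Longrightarrow> \<bar>coef u l - of_rat (r l)\<bar> \<le> \<delta> l" by metis
    \<comment> \<open>Position 0 is padding, so that list positions agree with indices.\<close>
    define xs where "xs = map r [0..<Suc n]"
    have q: "q xs l = (if l \<le> n then of_rat (r l) else 0)" for l
      by (simp add: q_def xs_def del: upt_Suc)
    define c where "c l = (if l \<le> n then coef u l else 0) - q xs l" for l
    have "(\<Sum>l\<in>F. besov_weight CARD('d) p \<sigma> l * \<bar>c l\<bar> powr p) \<le> (e / 2) powr p" if F: "finite F" "F \<subseteq> {1..}" for F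
    proof -
      have "besov_weight CARD('d) p \<sigma> l * \<bar>c l\<bar> powr p \<le> (if l \<le> n then (e / 2) powr p / (real n + 1) else 0)"
        if l: "l \<in> F" for l
      proof (cases "l \<le> n")
        case True
        have l1: "l \<ge> 1" using l F by auto
        then have "besov_weight CARD('d) p \<sigma> l * \<bar>c l\<bar> powr p \<le> besov_weight CARD('d) p \<sigma> l * \<delta> l powr p"
          using r[OF l1] p True by (intro mult_left_mono powr_mono2) (auto simp: c_def q)
        also have "\<dots> = (e / 2) powr p / (real n + 1)"
          using w[OF l1] p e by (simp add: \<delta>_def powr_powr)
        finally show ?thesis using True by simp
      qed (simp add: c_def q)
      then have "(\<Sum>l\<in>F. besov_weight CARD('d) p \<sigma> l * \<bar>c l\<bar> powr p) \<le> (\<Sum>l\<in>F. if l \<le> n then (e / 2) powr p / (real n + 1) else 0)"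
        by (rule sum_mono)
      also have "\<dots> = real (card (F \<inter> {..n})) * ((e / 2) powr p / (real n + 1))"
        using F by (simp add: sum.If_cases atMost_def)
      also have "\<dots> \<le> (real n + 1) * ((e / 2) powr p / (real n + 1))"
        using card_mono[of "{..n}" "F \<inter> {..n}"] by (intro mult_right_mono) auto
      finally show ?thesis by simp
    qed
    from lpI(2)[OF this] e have "lp_norm c \<le> e / 2" by simp
    moreover have "N (trunc n u - series (q xs)) = lp_norm c"
      unfolding besov_norm_eq by (intro lp_norm_cong) (simp add: coeff_linear coeff_trunc c_def)
    moreover have "N (u - series (q xs)) \<le> N (u - trunc n u) + N (trunc n u - series (q xs))"
      using u lp_q by (intro triangle) (auto simp: trunc_mem series_mem)
    ultimately have "N (u - series (q xs)) < e" using n by (simp add: commute)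
    then show ?thesis by (auto simp: D_def)
  qed
  then have "mtopology closure_of D = Y"
    using DY by (fastforce simp: metric_closure_of)
  then show ?thesis
    using \<open>countable D\<close> DY by (auto simp: separable_space_def norm_topology_def)
qed

lemma besov_separable_banach: "separable_banach_on Y N"
  using normed besov_mcomplete besov_separable by (simp add: separable_banach_on_def)

text \<open>The series of the k-th unit sequence is \<open>\<psi> k\<close> as a generalized
  function: it sends f in the span of the wavelets to
  \<open>torus_inner (\<psi> k) f\<close>.\<close>

definition trunc_space :: "nat \<Rightarrow> 'd genfun set" where
  "trunc_space n = span ((\<lambda>k. series (\<lambda>l. if l = k then 1 else 0)) ` {1..n})"

lemma trunc_space_finite_dim: "finite_dim_subspace (trunc_space n)"
  unfolding finite_dim_subspace_def trunc_space_def by blast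

lemma trunc_space_subset: "trunc_space n \<subseteq> Y"
  unfolding trunc_space_def
proof (rule span_minimal[OF _ subspace], safe)
  fix k assume "k \<in> {1..n}"
  have "lp (\<lambda>l. if l = k then 1 else 0)"
    unfolding lp_def
    by (rule summable_on_finite_support, rule finite_subset[of _ "{k}"]) auto
  then show "series (\<lambda>l. if l = k then 1 else 0) \<in> Y" by (rule series_mem)
qed

lemma trunc_in_trunc_space: "trunc n u \<in> trunc_space n"
proof (induction n)
  case 0
  have "trunc 0 u = series (\<lambda>_. 0)"
    unfolding wavelet_truncation_def by (rule wavelet_series_cong) simp
  then show ?case unfolding trunc_space_def by (simp only: wavelet_series_zero span_zero)
next
  case (Suc n)
  have "trunc (Suc n) u = trunc n u + coef u (Suc n) *\<^sub>R series (\<lambda>l. if l = Suc n then 1 else 0)"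
    unfolding wavelet_truncation_def
    by (subst wavelet_series_scale[symmetric], subst wavelet_series_add[OF orth, symmetric])
      (auto intro!: wavelet_series_cong simp: le_Suc_eq)
  moreover have "trunc n u \<in> trunc_space (Suc n)"
    using Suc span_mono[of "(\<lambda>k. series (\<lambda>l. if l = k then 1 else 0)) ` {1..n}"
        "(\<lambda>k. series (\<lambda>l. if l = k then 1 else 0)) ` {1..Suc n}"]
    by (auto simp: trunc_space_def image_mono)
  moreover have "series (\<lambda>l. if l = Suc n then 1 else 0) \<in> trunc_space (Suc n)"
    unfolding trunc_space_def by (intro span_base) auto
  ultimately show ?case
    unfolding trunc_space_def by (simp only: span_add span_scale)
qed

text \<open>The range carries the Borel sets of its own norm topology. Since the restricted norm
  makes it a normed carrier and truncation is 1-Lipschitz into it, no comparison with traces of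
  Borel sets of \<open>Y\<close> is made.\<close>

lemma trunc_measurable:
  "trunc n \<in> borel_on Y N \<rightarrow>\<^sub>M borel_on (trunc_space n) N"
proof (rule measurable_borel_on_Lipschitz[OF besov_normed_carrier])
  show "normed_carrier (trunc_space n) N"
  proof
    show "normed_space_on (trunc_space n) N"
      using normed trunc_space_subset[of n] unfolding normed_space_on_def trunc_space_def
      by (auto simp: subset_iff)
  qed (simp_all add: N_minus)
  show "N (trunc n u - trunc n v) \<le> 1 * N (u - v)" if "u \<in> Y" "v \<in> Y" for u v
    using trunc_Lipschitz[OF that] by simp
qed (use trunc_in_trunc_space in auto)

lemma proper_linear_discretizations_trunc:
  assumes "prob_space M" and V: "V \<in> M \<rightarrow>\<^sub>M borel_on Y N"
  shows "proper_linear_discretizations M Y N V (\<lambda>n \<omega>. trunc n (V \<omega>))"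
proof -
  interpret M: prob_space M by fact
  have VY: "V \<omega> \<in> Y" if "\<omega> \<in> space M" for \<omega>
    using measurable_space[OF V that] by (simp add: space_borel_on)
  have "weak_conv_m (\<lambda>n. distr M borel (\<lambda>\<omega>. y' (trunc n (V \<omega>)))) (distr M borel (\<lambda>\<omega>. y' (V \<omega>)))"
    if y': "y' \<in> dual_on Y N" for y'
  proof (rule M.weak_conv_m_distr_pointwise)
    have y'_meas: "y' \<in> borel_measurable (borel_on Y N)"
      by (rule dual_on_measurable[OF besov_normed_carrier y'])
    \<comment> \<open>Here truncation maps into all of \<open>Y\<close>, because \<open>y'\<close>
      is measurable for \<open>borel_on Y N\<close>.\<close>
    have "trunc n \<in> borel_on Y N \<rightarrow>\<^sub>M borel_on Y N" for n
      by (rule measurable_borel_on_Lipschitz[OF besov_normed_carrier besov_normed_carrier, where C = 1])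
        (use trunc_mem trunc_Lipschitz in auto)
    then show "(\<lambda>\<omega>. y' (trunc n (V \<omega>))) \<in> borel_measurable M" for n
      by (rule measurable_compose[OF measurable_compose[OF V] y'_meas])
    show "(\<lambda>\<omega>. y' (V \<omega>)) \<in> borel_measurable M"
      by (rule measurable_compose[OF V y'_meas])
    fix \<omega> assume \<omega>: "\<omega> \<in> space M"
    have "bounded_linear_on Y N abs y'" using y' by (simp add: dual_on_def)
    from bounded_linear_on_Lipschitz[OF this subspace]
    obtain C where C: "\<And>x y. x \<in> Y \<Longrightarrow> y \<in> Y \<Longrightarrow> \<bar>y' x - y' y\<bar> \<le> C * N (x - y)" by blast
    have "(\<lambda>n. y' (trunc n (V \<omega>)) - y' (V \<omega>)) \<longlonglongrightarrow> 0"
    proof (rule Lim_null_comparison)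
      show "\<forall>\<^sub>F n in sequentially. norm (y' (trunc n (V \<omega>)) - y' (V \<omega>)) \<le> C * N (trunc n (V \<omega>) - V \<omega>)"
        using C[OF trunc_mem VY] VY[OF \<omega>] \<omega> by simp
      show "(\<lambda>n. C * N (trunc n (V \<omega>) - V \<omega>)) \<longlonglongrightarrow> 0"
        using tendsto_mult_left[OF norm_trunc_diff_tendsto[OF VY[OF \<omega>]], of C] by simp
    qed
    then show "(\<lambda>n. y' (trunc n (V \<omega>))) \<longlonglongrightarrow> y' (V \<omega>)"
      by (rule LIM_zero_cancel)
  qed
  moreover have "(\<lambda>\<omega>. trunc n (V \<omega>)) \<in> M \<rightarrow>\<^sub>M borel_on (trunc_space n) N" for n
    by (rule measurable_compose[OF V trunc_measurable])
  ultimately show ?thesis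
    unfolding proper_linear_discretizations_def
    by (intro conjI ballI allI impI V besov_separable_banach exI[of _ trunc] trunc_bounded_operator
        exI[of _ "trunc_space _"] trunc_space_finite_dim trunc_space_subset refl) simp_all
qed

end

section \<open>The Besov prior\<close>

lemma integrable_exp_abs_half: "integrable lborel (\<lambda>x::real. exp (- \<bar>x\<bar> / 2))"
proof -
  define e :: "real \<Rightarrow> real" where "e = exponential_density (1 / 2)"
  have e: "integrable lborel e"
  proof (rule integrableI_nonneg)
    show "AE x in lborel. 0 \<le> e x"
      by (simp add: e_def exponential_density_def)
    have "(\<integral>\<^sup>+ x. e x \<partial>lborel) = emeasure (density lborel e) (space (density lborel e))"
      by (simp add: emeasure_density e_def)
    also have "\<dots> = 1"
      unfolding e_def by (intro prob_space.emeasure_space_1 prob_space_exponential_density) simp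
    finally show "(\<integral>\<^sup>+ x. e x \<partial>lborel) < \<infinity>" by simp
  qed (simp add: e_def)
  have "integrable lborel (\<lambda>x. e (0 + (- 1) * x))"
    by (rule lborel_integrable_real_affine[OF e]) simp
  \<comment> \<open>The factor 2 cancels the rate \<open>1 / 2\<close>. Off 0 this equals
    \<open>exp (- \<bar>x\<bar> / 2)\<close>; at 0 both halves count, which is harmless for a
    dominating function.\<close>
  with e have "integrable lborel (\<lambda>x. 2 * (e x + e (- x)))" by simp
  then show ?thesis
    by (rule Bochner_Integration.integrable_bound) (auto simp: e_def exponential_density_def)
qed

text \<open>With \<open>u = \<bar>x\<bar> powr p\<close>, the bound
  \<open>u \<le> 2 * exp (u / 2)\<close> lets half of the decay absorb the factor u, and
  \<open>\<bar>x\<bar> \<le> u + 1\<close> turns the other half into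
  \<open>exp (- \<bar>x\<bar> / 2)\<close> at the price of \<open>exp (1 / 2)\<close>. Using
  \<open>\<bar>Z\<bar>\<close> in the constant spares a proof that the normalization is
  positive.\<close>

lemma nn_integral_powr_exp_finite:
  assumes p: "1 \<le> p"
  shows "(\<integral>\<^sup>+ x. ennreal (exp (- (\<bar>x\<bar> powr p)) / Z) * ennreal (\<bar>x\<bar> powr p) \<partial>lborel) < \<infinity>"
proof -
  define C where "C = 2 * exp (1 / 2) / \<bar>Z\<bar>"
  have le: "exp (- (\<bar>x\<bar> powr p)) / Z * \<bar>x\<bar> powr p \<le> C * exp (- \<bar>x\<bar> / 2)" for x :: real
  proof -
    define u where "u = \<bar>x\<bar> powr p"
    have u: "u \<ge> 0" "\<bar>x\<bar> \<le> u + 1"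
    proof -
      show "u \<ge> 0" by (simp add: u_def)
      show "\<bar>x\<bar> \<le> u + 1"
      proof (cases "\<bar>x\<bar> \<le> 1")
        case False
        then have "\<bar>x\<bar> powr 1 \<le> u" unfolding u_def using p by (intro powr_mono) auto
        then show ?thesis using False by simp
      qed (use \<open>u \<ge> 0\<close> in simp)
    qed
    have "u \<le> 2 * exp (u / 2)" using exp_ge_add_one_self[of "u / 2"] by linarith
    then have "exp (- u) * u \<le> exp (- u) * (2 * exp (u / 2))" by (intro mult_left_mono) auto
    also have "\<dots> = 2 * exp (- u / 2)" by (simp add: exp_add[symmetric] mult.left_commute)
    also have "\<dots> \<le> 2 * exp (1 / 2 + - \<bar>x\<bar> / 2)" using u by simp
    also have "\<dots> = 2 * exp (1 / 2) * exp (- \<bar>x\<bar> / 2)" unfolding exp_add by simp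
    finally have *: "exp (- u) * u \<le> 2 * exp (1 / 2) * exp (- \<bar>x\<bar> / 2)" .
    have "exp (- u) / Z * u \<le> (exp (- u) * u) / \<bar>Z\<bar>"
      using u by (cases "Z \<ge> 0") (auto simp: divide_nonneg_neg mult_nonneg_nonneg intro: order_trans[of _ 0])
    also have "\<dots> \<le> 2 * exp (1 / 2) * exp (- \<bar>x\<bar> / 2) / \<bar>Z\<bar>"
      using * by (intro divide_right_mono) auto
    finally show ?thesis by (simp add: C_def u_def)
  qed
  have "(\<integral>\<^sup>+ x. ennreal (exp (- (\<bar>x\<bar> powr p)) / Z) * ennreal (\<bar>x\<bar> powr p) \<partial>lborel)
      \<le> (\<integral>\<^sup>+ x. ennreal (C * exp (- \<bar>x\<bar> / 2)) \<partial>lborel)"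
    by (intro nn_integral_mono) (simp only: ennreal_mult''[symmetric] powr_ge_zero ennreal_leI le)
  also have "\<dots> < \<infinity>"
  proof -
    have "integrable lborel (\<lambda>x::real. C * exp (- \<bar>x\<bar> / 2))"
      by (intro integrable_mult_right integrable_exp_abs_half)
    then show ?thesis
      by (subst nn_integral_eq_integral) (auto simp: C_def)
  qed
  finally show ?thesis .
qed

text \<open>Sum and integral of nonnegative terms commute, and a function with finite integral is
  finite almost everywhere.\<close>

lemma AE_summable_of_nn_integral:
  fixes f :: "nat \<Rightarrow> 'a \<Rightarrow> real"
  assumes [measurable]: "\<And>n. f n \<in> borel_measurable M"
    and nonneg: "\<And>n \<omega>. 0 \<le> f n \<omega>"
    and fin: "(\<Sum>n. \<integral>\<^sup>+ \<omega>. f n \<omega> \<partial>M) < \<infinity>"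
  shows "AE \<omega> in M. summable (\<lambda>n. f n \<omega>)"
proof -
  have "(\<integral>\<^sup>+ \<omega>. (\<Sum>n. ennreal (f n \<omega>)) \<partial>M) \<noteq> \<infinity>"
    using fin by (subst nn_integral_suminf) auto
  then have "AE \<omega> in M. (\<Sum>n. ennreal (f n \<omega>)) \<noteq> \<infinity>"
    by (intro nn_integral_noteq_infinite) auto
  then show ?thesis
    by eventually_elim (auto intro!: summable_suminf_not_top nonneg)
qed

section \<open>Random wavelet series\<close>

context besov
begin

text \<open>Membership at every outcome makes the unordered sum a pointwise limit of measurable
  partial sums.\<close>

lemma lp_norm_measurable:
  assumes lp: "\<And>\<omega>. \<omega> \<in> space M \<Longrightarrow> lp (c \<omega>)"
    and [measurable]: "\<And>l. l \<ge> 1 \<Longrightarrow> (\<lambda>\<omega>. c \<omega> l) \<in> borel_measurable M"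
  shows "(\<lambda>\<omega>. lp_norm (c \<omega>)) \<in> borel_measurable M"
proof -
  have "(\<lambda>\<omega>. \<Sum>\<^sub>\<infinity>l\<in>{1..}. besov_weight CARD('d) p \<sigma> l * \<bar>c \<omega> l\<bar> powr p) \<in> borel_measurable M"
  proof (rule borel_measurable_LIMSEQ_real)
    show "(\<lambda>n. \<Sum>l=1..n. besov_weight CARD('d) p \<sigma> l * \<bar>c \<omega> l\<bar> powr p) \<longlonglongrightarrow>
        (\<Sum>\<^sub>\<infinity>l\<in>{1..}. besov_weight CARD('d) p \<sigma> l * \<bar>c \<omega> l\<bar> powr p)" if "\<omega> \<in> space M" for \<omega>
      using lp[OF that] unfolding lp_def by (rule sum_tendsto_infsum)
    show "(\<lambda>\<omega>. \<Sum>l=1..n. besov_weight CARD('d) p \<sigma> l * \<bar>c \<omega> l\<bar> powr p) \<in> borel_measurable M" for n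
    proof (rule borel_measurable_sum)
      fix l assume "l \<in> {1..n}"
      then have [measurable]: "(\<lambda>\<omega>. c \<omega> l) \<in> borel_measurable M" using assms(2) by simp
      show "(\<lambda>\<omega>. besov_weight CARD('d) p \<sigma> l * \<bar>c \<omega> l\<bar> powr p) \<in> borel_measurable M"
        by measurable
    qed
  qed
  then show ?thesis unfolding lp_norm_def by measurable
qed

lemma series_measurable:
  assumes lp: "\<And>\<omega>. \<omega> \<in> space M \<Longrightarrow> lp (c \<omega>)"
    and meas: "\<And>l. l \<ge> 1 \<Longrightarrow> (\<lambda>\<omega>. c \<omega> l) \<in> borel_measurable M"
  shows "(\<lambda>\<omega>. series (c \<omega>)) \<in> M \<rightarrow>\<^sub>M borel_on Y N"
proof (rule measurable_borel_onI[OF besov_separable])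
  show "(\<lambda>\<omega>. series (c \<omega>)) \<in> space M \<rightarrow> Y"
    using lp by (auto intro: series_mem)
  fix u assume u: "u \<in> Y"
  have "N (u - series (c \<omega>)) = lp_norm (\<lambda>l. coef u l - c \<omega> l)" for \<omega>
    unfolding besov_norm_eq by (intro lp_norm_cong) (simp add: coeff_linear)
  moreover have "(\<lambda>\<omega>. lp_norm (\<lambda>l. coef u l - c \<omega> l)) \<in> borel_measurable M"
    by (intro lp_norm_measurable lp_diff lp lp_coeff[OF u])
      (auto intro!: borel_measurable_diff meas)
  ultimately show "(\<lambda>\<omega>. N (u - series (c \<omega>))) \<in> borel_measurable M" by simp
qed

text \<open>The terms of the Besov series of the prior have expectations proportional to
  \<open>l powr (p * (\<sigma> - s) / d)\<close>, and \<open>p * (\<sigma> - s) / d < -1\<close>.\<close>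

lemma prior_AE_lp:
  assumes X: "\<And>l. l \<ge> 1 \<Longrightarrow> distributed M lborel (X l)
      (\<lambda>x. ennreal (exp (- (\<bar>x\<bar> powr p)) / (LINT z|lborel. exp (- (\<bar>z\<bar> powr p)))))"
    and s: "\<sigma> < s - real CARD('d) / p"
  shows "AE \<omega> in M. lp (\<lambda>l. real l powr (- (s / real CARD('d) + 1 / 2 - 1 / p)) * X l \<omega>)"
proof -
  define d where "d = real CARD('d)"
  have d: "d > 0" by (simp add: d_def)
  define Z where "Z = (LINT z|lborel. exp (- (\<bar>z::real\<bar> powr p)))"
  define K where "K = (\<integral>\<^sup>+ x. ennreal (exp (- (\<bar>x\<bar> powr p)) / Z) * ennreal (\<bar>x\<bar> powr p) \<partial>lborel)"
  define a where "a = p * (\<sigma> - s) / d"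
  \<comment> \<open>Shifted by one, since \<open>summable\<close> counts from 0 and the wavelets
    from 1.\<close>
  define f where "f n \<omega> = real (Suc n) powr a * \<bar>X (Suc n) \<omega>\<bar> powr p" for n \<omega>
  have a: "a < -1" using s d p by (simp add: a_def d_def field_simps)
  have [measurable]: "X (Suc n) \<in> borel_measurable M" for n
    using distributed_measurable[OF X[of "Suc n"]] by simp
  \<comment> \<open>All \<open>X l\<close> share one density, so the moment \<open>K\<close> is the
    same for every n.\<close>
  have f_int: "(\<integral>\<^sup>+ \<omega>. f n \<omega> \<partial>M) = ennreal (real (Suc n) powr a) * K" for n
  proof -
    have "(\<integral>\<^sup>+ \<omega>. ennreal (\<bar>X (Suc n) \<omega>\<bar> powr p) \<partial>M) = K"
      unfolding K_def Z_def by (rule distributed_nn_integral[OF X, symmetric]) auto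
    then show ?thesis by (simp add: f_def ennreal_mult nn_integral_cmult)
  qed
  have "AE \<omega> in M. summable (\<lambda>n. f n \<omega>)"
  proof (rule AE_summable_of_nn_integral)
    have "summable (\<lambda>n. real (Suc n) powr a)"
      using a summable_Suc_iff[of "\<lambda>n. real n powr a"] by (simp add: summable_real_powr_iff)
    then have "(\<Sum>n. ennreal (real (Suc n) powr a)) < \<infinity>"
      by (subst suminf_ennreal2) auto
    moreover have "K < \<infinity>" unfolding K_def by (rule nn_integral_powr_exp_finite[OF p])
    ultimately show "(\<Sum>n. \<integral>\<^sup>+ \<omega>. f n \<omega> \<partial>M) < \<infinity>"
      unfolding f_int by (simp add: ennreal_suminf_multc ennreal_mult_less_top)
  qed (auto simp: f_def)
  then show ?thesis
  proof eventually_elim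
    case (elim \<omega>)
    have eq: "besov_weight CARD('d) p \<sigma> l * \<bar>real l powr (- (s / real CARD('d) + 1 / 2 - 1 / p)) * X l \<omega>\<bar> powr p
        = real l powr a * \<bar>X l \<omega>\<bar> powr p" for l
    proof -
      \<comment> \<open>The terms \<open>p / 2\<close> and \<open>1\<close> of the weight cancel
        against p times the prior exponent.\<close>
      have "(p * \<sigma> / d + p / 2 - 1) + - (s / d + 1 / 2 - 1 / p) * p = a"
        using p d by (simp add: a_def field_simps)
      then show ?thesis
        by (simp add: abs_mult powr_mult powr_powr d_def mult.assoc[symmetric] flip: powr_add)
    qed
    have "summable (\<lambda>l. real l powr a * \<bar>X l \<omega>\<bar> powr p)"
      using elim unfolding f_def by (subst summable_Suc_iff[symmetric])
    then have "(\<lambda>l. real l powr a * \<bar>X l \<omega>\<bar> powr p) summable_on UNIV"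
      by (intro norm_summable_imp_summable_on) simp
    then show ?case
      unfolding lp_def eq by (rule summable_on_subset_banach) simp
  qed
qed

text \<open>The outcomes with coefficients outside the space are covered by a measurable null set
  \<open>B\<close>; putting all coefficients to 0 on \<open>B\<close> gives membership everywhere
  and changes U only on a null set.\<close>

lemma prior_valued_version:
  assumes prior: "besov_prior M \<psi> p s U" and s: "\<sigma> < s - real CARD('d) / p"
  shows "\<exists>V. valued_version M Y N U V"
proof -
  obtain X where X: "\<And>l. l \<ge> 1 \<Longrightarrow> distributed M lborel (X l)
      (\<lambda>x. ennreal (exp (- (\<bar>x\<bar> powr p)) / (LINT z|lborel. exp (- (\<bar>z\<bar> powr p)))))"
    and U: "AE \<omega> in M. U \<omega> = series (\<lambda>l. real l powr (- (s / real CARD('d) + 1 / 2 - 1 / p)) * X l \<omega>)"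
    using prior unfolding besov_prior_def by blast
  define c where "c \<omega> l = real l powr (- (s / real CARD('d) + 1 / 2 - 1 / p)) * X l \<omega>" for \<omega> l
  have "AE \<omega> in M. lp (c \<omega>)"
    unfolding c_def[abs_def] by (rule prior_AE_lp[OF X s])
  then obtain B where B: "{\<omega> \<in> space M. \<not> lp (c \<omega>)} \<subseteq> B" "B \<in> null_sets M"
    by (elim AE_E) (auto simp: null_sets_def)
  define c' where "c' \<omega> = (if \<omega> \<in> B then (\<lambda>_. 0) else c \<omega>)" for \<omega>
  have "valued_version M Y N U (\<lambda>\<omega>. series (c' \<omega>))"
    unfolding valued_version_def
  proof
    show "(\<lambda>\<omega>. series (c' \<omega>)) \<in> M \<rightarrow>\<^sub>M borel_on Y N"
    proof (rule series_measurable)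
      show "lp (c' \<omega>)" if "\<omega> \<in> space M" for \<omega>
        using B(1) that by (auto simp: c'_def lp_zero)
      fix l :: nat assume "l \<ge> 1"
      have [measurable]: "X l \<in> borel_measurable M"
        using distributed_measurable[OF X[OF \<open>l \<ge> 1\<close>]] by simp
      have [measurable]: "B \<in> sets M" using B(2) by auto
      have "(\<lambda>\<omega>. c' \<omega> l) = (\<lambda>\<omega>. if \<omega> \<in> B then 0 else c \<omega> l)"
        by (auto simp: c'_def)
      also have "\<dots> \<in> borel_measurable M" unfolding c_def by measurable
      finally show "(\<lambda>\<omega>. c' \<omega> l) \<in> borel_measurable M" .
    qed
    show "AE \<omega> in M. series (c' \<omega>) = U \<omega>"
      using U AE_not_in[OF B(2)] by eventually_elim (simp add: c'_def c_def[abs_def])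
  qed
  then show ?thesis by blast
qed

end

text \<open>The existence of a version V keeps the final claim, which is about all versions, from
  being vacuous.\<close>

theorem proposition11:
  fixes \<psi> :: "nat \<Rightarrow> real^'d \<Rightarrow> real"
    and M :: "'w measure"
    and U :: "'w \<Rightarrow> 'd genfun"
    and p s t :: real
    and r :: nat
  defines "Y \<equiv> besov_space \<psi> p t"
    and "N \<equiv> besov_norm \<psi> p t"
    and "T \<equiv> wavelet_truncation \<psi>"
  assumes p: "1 \<le> p"
    and basis: "torus_wavelet_basis r \<psi>"
    and regularity: "max \<bar>s\<bar> \<bar>t\<bar> < real r"
    and prob: "prob_space M"
    and prior: "besov_prior M \<psi> p s U"
    and t: "t < s - real CARD('d) / p"
  shows "(\<forall>n\<ge>1. bounded_operator_on Y N (T n)) \<and>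
    (\<forall>y\<in>Y. limitin (norm_topology Y N) (\<lambda>n. T n y) y sequentially) \<and>
    (\<exists>V. valued_version M Y N U V) \<and>
    (\<forall>V. valued_version M Y N U V \<longrightarrow>
       proper_linear_discretizations M Y N V (\<lambda>n \<omega>. T n (V \<omega>)))"
proof -
  interpret besov \<psi> p t
    by standard
      (use p basis in \<open>auto simp: torus_wavelet_basis_def torus_orthonormal_basis_def\<close>)
  show ?thesis
    unfolding Y_def N_def T_def
    using trunc_bounded_operator trunc_limitin prior_valued_version[OF prior t]
      proper_linear_discretizations_trunc[OF prob]
    by (auto simp: valued_version_def)
qed

end
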